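(* Let $A \subset \mathbb{R}^d$ be a bounded set. Let $M \in \mathbb{R}^{d\times d}$ be a rotation matrix and let $w = \max_{a\in\partial A}|a-Ma|$. Then $$\mathcal{H}^d(A \bigtriangleup MA) \le \left(\frac{2d}{d+1}\right)^{\frac{d-1}{2}} w \, \mathcal{H}^{d-1}(\partial A).$$
   Context: Notation: $|\cdot|$ is the Euclidean norm; a rotation matrix is an element of the special orthogonal group $SO(d)\subset\mathbb{R}^{d\times d}$; $MA=\{Ma : a\in A\}$; $A \bigtriangleup B = (A\setminus B)\cup(B\setminus A)$; the boundary $\partial A$ is $\operatorname{cl}(A)\setminus\operatorname{int}(A)$. Hausdorff measure: for an integer $0\le k\le d$, let $\omega_k$ denote the volume of the Euclidean unit ball in $\mathbb{R}^k$ (with $\omega_0=1$). For an arbitrary set $A\subset\mathbb{R}^d$ (no measurability required) and $\delta>0$ put $$\mathcal{H}^k_\delta(A)=\omega_k 2^{-k}\inf\Bigl\{\sum_{j=0}^\infty(\operatorname{diam}B_j)^k : B_j\subset\mathbb{R}^d,\ \operatorname{diam}B_j\le\delta \text{ for all } j,\ A\subset\bigcup_{j=0}^\infty B_j\Bigr\},$$ and $\mathcal{H}^k(A)=\lim_{\delta\to 0^+}\mathcal{H}^k_\delta(A)\in[0,\infty]$ (for $k=0$, $(\operatorname{diam} B)^0$ is $1$ for nonempty $B$ and $0$ for $B=\emptyset$, so $\mathcal{H}^0$ is counting measure). With this normalization $\mathcal{H}^d$ agrees with Lebesgue measure on Lebesgue measurable subsets of $\mathbb{R}^d$. *)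

theory Defs
  imports "HOL-Analysis.Analysis"
begin

text \<open>
  Hausdorff measures as outer measures on arbitrary sets, normalized by the volume of the
  unit ball. Covering sets are required to be bounded explicitly because \<^const>\<open>diameter\<close>
  is real-valued and meaningless on unbounded sets; a set of diameter at most \<open>\<delta> < \<infinity>\<close> is bounded.
\<close>

text \<open>The case distinction makes \<open>diam_pow 0 {} = 0\<close>, whereas \<open>0 ^ 0 = 1\<close> is used for points.\<close>

definition diam_pow :: "nat \<Rightarrow> 'a::metric_space set \<Rightarrow> real" where
  "diam_pow k B = (if B = {} then 0 else diameter B ^ k)"

definition hausdorff_pre :: "nat \<Rightarrow> real \<Rightarrow> 'a::metric_space set \<Rightarrow> ennreal" where
  "hausdorff_pre k \<delta> A =
     ennreal (unit_ball_vol (real k) / 2 ^ k) *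
     Inf {(\<Sum>j. ennreal (diam_pow k (B j))) | B :: nat \<Rightarrow> 'a set.
            (\<forall>j. bounded (B j) \<and> diameter (B j) \<le> \<delta>) \<and> A \<subseteq> (\<Union>j. B j)}"

definition hausdorff_measure :: "nat \<Rightarrow> 'a::metric_space set \<Rightarrow> ennreal" where
  "hausdorff_measure k A = Lim (at_right 0) (\<lambda>\<delta>. hausdorff_pre k \<delta> A)"

lemma hausdorff_pre_antimono:
  fixes A :: "'a::metric_space set"
  assumes "\<delta> \<le> \<epsilon>"
  shows "hausdorff_pre k \<epsilon> A \<le> hausdorff_pre k \<delta> A"
  unfolding hausdorff_pre_def
proof (rule mult_left_mono[OF Inf_superset_mono zero_le], rule subsetI, elim CollectE exE conjE)
  fix x and B :: "nat \<Rightarrow> 'a set"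
  assume "x = (\<Sum>j. ennreal (diam_pow k (B j)))" "A \<subseteq> (\<Union>j. B j)"
    and B: "\<forall>j. bounded (B j) \<and> diameter (B j) \<le> \<delta>"
  moreover have "\<forall>j. bounded (B j) \<and> diameter (B j) \<le> \<epsilon>"
    using B assms order_trans by blast
  ultimately show "x \<in> {(\<Sum>j. ennreal (diam_pow k (B j))) | B :: nat \<Rightarrow> 'a set.
            (\<forall>j. bounded (B j) \<and> diameter (B j) \<le> \<epsilon>) \<and> A \<subseteq> (\<Union>j. B j)}"
    by (intro CollectI exI[of _ B] conjI)
qed

lemma tendsto_hausdorff_pre:
  "((\<lambda>\<delta>. hausdorff_pre k \<delta> A) \<longlongrightarrow> (SUP \<delta>\<in>{0<..}. hausdorff_pre k \<delta> A)) (at_right 0)"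
proof (rule order_tendstoI)
  fix a assume "a < (SUP \<delta>\<in>{0<..}. hausdorff_pre k \<delta> A)"
  then obtain \<epsilon> where \<epsilon>: "\<epsilon> > 0" "a < hausdorff_pre k \<epsilon> A"
    by (auto simp: less_SUP_iff)
  have "\<forall>\<^sub>F \<delta> in at_right 0. \<delta> < \<epsilon>"
    using \<epsilon>(1) by (auto simp: eventually_at_right_field)
  then show "\<forall>\<^sub>F \<delta> in at_right 0. a < hausdorff_pre k \<delta> A"
  proof eventually_elim
    case (elim \<delta>)
    then show ?case
      using \<epsilon>(2) hausdorff_pre_antimono[OF less_imp_le, of \<delta> \<epsilon> k A] by (rule_tac less_le_trans)
  qed
next
  fix a assume a: "(SUP \<delta>\<in>{0<..}. hausdorff_pre k \<delta> A) < a"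
  have "\<forall>\<^sub>F \<delta> in at_right (0::real). \<delta> > 0"
    by (rule eventually_at_right_less)
  then show "\<forall>\<^sub>F \<delta> in at_right 0. hausdorff_pre k \<delta> A < a"
    by eventually_elim (rule le_less_trans[OF SUP_upper a], simp)
qed

lemma hausdorff_measure_eq_SUP:
  "hausdorff_measure k A = (SUP \<delta>\<in>{0<..}. hausdorff_pre k \<delta> A)"
  unfolding hausdorff_measure_def
  by (rule tendsto_Lim[OF trivial_limit_at_right_real tendsto_hausdorff_pre])

text \<open>
  The largest displacement of a boundary point is written as a supremum in \<^typ>\<open>ennreal\<close>, which
  also covers the empty set, where it is \<open>0\<close>; otherwise it is a maximum.
\<close>

lemma displacement_SUP_attained:
  fixes A :: "(real ^ 'n) set"
  assumes "bounded A" "A \<noteq> {}"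
  shows "\<exists>a\<in>frontier A. (\<forall>b\<in>frontier A. norm (b - M *v b) \<le> norm (a - M *v a)) \<and>
           (SUP b\<in>frontier A. ennreal (norm (b - M *v b))) = ennreal (norm (a - M *v a))"
proof -
  have "A \<noteq> UNIV"
    using assms(1) not_bounded_UNIV by blast
  then have ne: "frontier A \<noteq> {}"
    using assms(2) by (simp add: frontier_eq_empty)
  have "continuous_on (frontier A) (\<lambda>a. norm (a - M *v a))"
    by (intro continuous_intros linear_continuous_on
        matrix_vector_mul_linear[THEN linear_conv_bounded_linear[THEN iffD1]])
  then obtain a where a: "a \<in> frontier A"
      "\<forall>b\<in>frontier A. norm (b - M *v b) \<le> norm (a - M *v a)"
    using continuous_attains_sup[OF compact_frontier_bounded[OF assms(1)] ne] by blast
  then have "(SUP b\<in>frontier A. ennreal (norm (b - M *v b))) = ennreal (norm (a - M *v a))"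
    by (intro antisym SUP_least SUP_upper ennreal_leI) auto
  with a show ?thesis by blast
qed

end

theory Submission
  imports Defs
begin

text \<open>
  Write \<open>d\<close> for the dimension and \<open>N\<^sub>s = (1 - s) I + s M\<close>, so that \<open>N\<^sub>s a\<close> runs from \<open>a\<close> to \<open>M a\<close>. The
  symmetric difference of \<open>A\<close> and \<open>M A\<close> is swept out by the segments from \<open>a\<close> to \<open>M a\<close> with \<open>a\<close> on the
  boundary of \<open>A\<close>: if \<open>x\<close> is in exactly one of the two sets, then the path \<open>N\<^sub>s\<^sup>-\<^sup>1 x\<close> from \<open>x\<close> to \<open>M\<^sup>-\<^sup>1 x\<close>
  has exactly one end in \<open>A\<close> and must cross the boundary. As \<open>M\<close> is an isometry, \<open>N\<^sub>s\<close> can only be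
  singular for \<open>s = 1 / 2\<close>. In that case the range of \<open>N\<^sub>s\<close> is a null set, and for \<open>x\<close> outside this range
  the path runs off to infinity at \<open>s = 1 / 2\<close>, so the half of it that starts in the bounded set \<open>A\<close>
  leaves \<open>A\<close> (\<open>sym_diff_subset_boundary_sweep\<close>).

  It remains to estimate the volume swept by the boundary. Cover the boundary by sets \<open>B\<close> of
  diameter at most \<open>\<delta>\<close>. By Jung's theorem (\<open>jung\<close>) such a set lies in a ball whose radius \<open>r\<close> is
  \<open>sqrt (d / (2 (d + 1)))\<close> times the diameter of \<open>B\<close>. Since \<open>N\<^sub>s\<close> does not increase norms, the region
  swept by \<open>B\<close> lies in a cylinder of radius \<open>r\<close> and length at most \<open>w + 4 r\<close>, of volume
  \<open>\<omega>\<^sub>d\<^sub>-\<^sub>1 r\<^sup>d\<^sup>-\<^sup>1 (w + 4 r)\<close> (\<open>hausdorff_measure_sweep_le\<close>). Up to the factor \<open>w + 4 r\<close> this is the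
  contribution of \<open>B\<close> to the \<open>(d - 1)\<close>-dimensional Hausdorff measure times the \<open>(d - 1)\<close>-st power of
  \<open>2 sqrt (d / (2 (d + 1)))\<close>, which is the constant in the theorem. Summing over the cover and letting
  \<open>\<delta>\<close> tend to zero gives the bound.

  All volumes are measured by the \<open>d\<close>-dimensional Hausdorff measure itself. It is countably
  subadditive, it does not grow under isometries, and it is bounded by Lebesgue measure
  (\<open>hausdorff_measure_le_lebesgue\<close>, by Vitali's covering theorem); no more is needed to estimate it
  on null sets and cylinders.
\<close>

section \<open>Hausdorff measure as an outer measure\<close>

text \<open>
Covers indexed by an arbitrary countable set are as good as sequences: the missing indices are
filled with the empty set, which costs nothing because \<open>diam_pow k {} = 0\<close> even for \<open>k = 0\<close>.
\<close>

lemma hausdorff_pre_le_countable_cover: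
  fixes S :: "'a::metric_space set" and B :: "'i \<Rightarrow> 'a set"
  assumes I: "countable I" and cover: "S \<subseteq> (\<Union>i\<in>I. B i)" and "0 \<le> \<delta>"
    and small: "\<And>i. i \<in> I \<Longrightarrow> bounded (B i) \<and> diameter (B i) \<le> \<delta>"
  shows "hausdorff_pre k \<delta> S
    \<le> ennreal (unit_ball_vol (real k) / 2 ^ k) * (\<integral>\<^sup>+i. ennreal (diam_pow k (B i)) \<partial>count_space I)"
proof -
  define g where "g = to_nat_on I"
  have inj: "inj_on g I" unfolding g_def using I by (rule inj_on_to_nat_on)
  define B' where "B' n = (if n \<in> g ` I then B (the_inv_into I g n) else {})" for n
  have B'g: "B' (g i) = B i" if "i \<in> I" for i
    using that inj by (simp add: B'_def the_inv_into_f_f)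
  have "(\<Sum>n. ennreal (diam_pow k (B' n))) = (\<integral>\<^sup>+n. ennreal (diam_pow k (B' n)) \<partial>count_space UNIV)"
    by (simp add: nn_integral_count_space_nat)
  also have "\<dots> = (\<integral>\<^sup>+n. ennreal (diam_pow k (B' n)) * indicator (g ` I) n \<partial>count_space UNIV)"
    by (intro nn_integral_cong) (auto simp: B'_def diam_pow_def indicator_def)
  also have "\<dots> = (\<integral>\<^sup>+n. ennreal (diam_pow k (B' n)) \<partial>count_space (g ` I))"
    by (simp add: nn_integral_count_space_indicator)
  also have "\<dots> = (\<integral>\<^sup>+i. ennreal (diam_pow k (B' (g i))) \<partial>count_space I)"
    by (rule nn_integral_bij_count_space[symmetric]) (simp add: inj inj_on_imp_bij_betw)
  also have "\<dots> = (\<integral>\<^sup>+i. ennreal (diam_pow k (B i)) \<partial>count_space I)"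
    by (intro nn_integral_cong) (simp add: B'g)
  finally have sum: "(\<Sum>n. ennreal (diam_pow k (B' n)))
    = (\<integral>\<^sup>+i. ennreal (diam_pow k (B i)) \<partial>count_space I)" .
  have "\<forall>n. bounded (B' n) \<and> diameter (B' n) \<le> \<delta>"
  proof
    fix n show "bounded (B' n) \<and> diameter (B' n) \<le> \<delta>"
      using small B'g \<open>0 \<le> \<delta>\<close> by (cases "n \<in> g ` I") (auto, auto simp: B'_def)
  qed
  moreover have "S \<subseteq> (\<Union>n. B' n)"
    using cover B'g by blast
  ultimately show ?thesis
    unfolding hausdorff_pre_def sum[symmetric]
    by (intro mult_left_mono Inf_lower) auto
qed

text \<open>
The normalizing constant is finite and positive, so near-optimal covers for the infimum remain
near-optimal after multiplication by it.
\<close>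

lemma hausdorff_pre_obtain_cover:
  fixes S :: "'a::metric_space set"
  assumes "hausdorff_pre k \<delta> S < \<infinity>" "0 < e"
  obtains B :: "nat \<Rightarrow> 'a set" where "\<And>j. bounded (B j)" "\<And>j. diameter (B j) \<le> \<delta>" "S \<subseteq> (\<Union>j. B j)"
    "ennreal (unit_ball_vol (real k) / 2 ^ k) * (\<Sum>j. ennreal (diam_pow k (B j)))
      \<le> hausdorff_pre k \<delta> S + ennreal e"
proof -
  define c where "c = unit_ball_vol (real k) / 2 ^ k"
  have "0 < c" by (simp add: c_def)
  define X where "X = {(\<Sum>j. ennreal (diam_pow k (B j))) | B :: nat \<Rightarrow> 'a set.
            (\<forall>j. bounded (B j) \<and> diameter (B j) \<le> \<delta>) \<and> S \<subseteq> (\<Union>j. B j)}"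
  have pre: "hausdorff_pre k \<delta> S = ennreal c * Inf X"
    by (simp add: hausdorff_pre_def X_def c_def)
  have "Inf X \<noteq> \<infinity>"
  proof
    assume "Inf X = \<infinity>"
    have "hausdorff_pre k \<delta> S = \<infinity>"
      unfolding pre \<open>Inf X = \<infinity>\<close> using \<open>0 < c\<close> by (simp add: ennreal_mult_top)
    then show False using assms(1) by simp
  qed
  then have "Inf X < Inf X + ennreal (e / c)"
    using \<open>0 < e\<close> \<open>0 < c\<close> by (simp add: ennreal_add_left_cancel_less less_top)
  then obtain y where y: "y \<in> X" "y < Inf X + ennreal (e / c)"
    by (auto simp: Inf_less_iff)
  then obtain B :: "nat \<Rightarrow> 'a set" where B: "\<forall>j. bounded (B j) \<and> diameter (B j) \<le> \<delta>"
    "S \<subseteq> (\<Union>j. B j)" "y = (\<Sum>j. ennreal (diam_pow k (B j)))"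
    unfolding X_def by blast
  have "ennreal c * y \<le> ennreal c * (Inf X + ennreal (e / c))"
    using y(2) by (intro mult_left_mono) auto
  also have "\<dots> = hausdorff_pre k \<delta> S + ennreal e"
    using \<open>0 < c\<close> \<open>0 < e\<close> by (simp add: pre distrib_left ennreal_mult'[symmetric])
  finally show thesis
    using B by (intro that[of B]) (auto simp: c_def)
qed

text \<open>
The usual argument for outer measures: the \<open>j\<close>-th set is covered with excess \<open>e / 2\<^sup>j\<^sup>+\<^sup>1\<close> and the
doubly indexed family of all these pieces covers the union.
\<close>

lemma hausdorff_pre_UN_le:
  fixes S :: "nat \<Rightarrow> 'a::metric_space set"
  assumes "0 < \<delta>"
  shows "hausdorff_pre k \<delta> (\<Union>j. S j) \<le> (\<Sum>j. hausdorff_pre k \<delta> (S j))"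
proof (cases "\<exists>j. hausdorff_pre k \<delta> (S j) = \<infinity>")
  case True
  then obtain j where "hausdorff_pre k \<delta> (S j) = \<infinity>" by blast
  moreover have "hausdorff_pre k \<delta> (S j) \<le> (\<Sum>j. hausdorff_pre k \<delta> (S j))"
    using sum_le_suminf[of "\<lambda>j. hausdorff_pre k \<delta> (S j)" "{j}"] by simp
  ultimately show ?thesis by (simp add: top_unique)
next
  case False
  show ?thesis
  proof (rule ennreal_le_epsilon)
    fix e :: real assume "0 < e"
    define c where "c = ennreal (unit_ball_vol (real k) / 2 ^ k)"
    have "\<exists>B. (\<forall>i. bounded (B i) \<and> diameter (B i) \<le> \<delta>) \<and> S j \<subseteq> (\<Union>i. B i) \<and>
        c * (\<Sum>i. ennreal (diam_pow k (B i))) \<le> hausdorff_pre k \<delta> (S j) + ennreal (e * (1/2) ^ Suc j)" for j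
    proof -
      have "hausdorff_pre k \<delta> (S j) < \<infinity>" "0 < e * (1/2) ^ Suc j"
        using False \<open>0 < e\<close> by (auto simp: less_top)
      from hausdorff_pre_obtain_cover[OF this] show ?thesis
        unfolding c_def by metis
    qed
    then obtain B where B: "\<And>j i. bounded (B j i)" "\<And>j i. diameter (B j i) \<le> \<delta>"
      "\<And>j. S j \<subseteq> (\<Union>i. B j i)"
      "\<And>j. c * (\<Sum>i. ennreal (diam_pow k (B j i))) \<le> hausdorff_pre k \<delta> (S j) + ennreal (e * (1/2) ^ Suc j)"
      by metis
    have "hausdorff_pre k \<delta> (\<Union>j. S j)
        \<le> c * (\<integral>\<^sup>+p. ennreal (diam_pow k (case_prod B p)) \<partial>count_space UNIV)"
      unfolding c_def
    proof (rule hausdorff_pre_le_countable_cover)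
      show "(\<Union>j. S j) \<subseteq> (\<Union>p\<in>UNIV. case_prod B p)"
        using B(3) by fastforce
    qed (use B assms in auto)
    also have "(\<integral>\<^sup>+p. ennreal (diam_pow k (case_prod B p)) \<partial>count_space UNIV)
        = (\<integral>\<^sup>+j. \<integral>\<^sup>+i. ennreal (diam_pow k (B j i)) \<partial>count_space UNIV \<partial>count_space UNIV)"
      by (subst nn_integral_fst_count_space[symmetric]) simp
    also have "\<dots> = (\<Sum>j. \<Sum>i. ennreal (diam_pow k (B j i)))"
      by (simp add: nn_integral_count_space_nat)
    also have "c * \<dots> = (\<Sum>j. c * (\<Sum>i. ennreal (diam_pow k (B j i))))"
      by simp
    also have "\<dots> \<le> (\<Sum>j. hausdorff_pre k \<delta> (S j) + ennreal (e * (1/2) ^ Suc j))"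
      by (intro suminf_le B(4)) auto
    also have "\<dots> = (\<Sum>j. hausdorff_pre k \<delta> (S j)) + (\<Sum>j. ennreal (e * (1/2) ^ Suc j))"
      by (rule suminf_add[symmetric]) auto
    also have "(\<Sum>j. ennreal (e * (1/2) ^ Suc j)) = ennreal e"
    proof (rule suminf_ennreal_eq)
      show "(\<lambda>j. e * (1/2) ^ Suc j) sums e"
        using sums_mult[OF power_half_series, of e] by simp
    qed (use \<open>0 < e\<close> in simp)
    finally show "hausdorff_pre k \<delta> (\<Union>j. S j) \<le> (\<Sum>j. hausdorff_pre k \<delta> (S j)) + ennreal e" .
  qed
qed

lemma hausdorff_pre_le_measure: "0 < \<delta> \<Longrightarrow> hausdorff_pre k \<delta> S \<le> hausdorff_measure k S"
  unfolding hausdorff_measure_eq_SUP by (rule SUP_upper) simp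

lemma hausdorff_measure_UN_le:
  fixes S :: "nat \<Rightarrow> 'a::metric_space set"
  shows "hausdorff_measure k (\<Union>j. S j) \<le> (\<Sum>j. hausdorff_measure k (S j))"
  unfolding hausdorff_measure_eq_SUP[of k "\<Union>j. S j"]
proof (rule SUP_least)
  fix \<delta> :: real assume "\<delta> \<in> {0<..}"
  then have "hausdorff_pre k \<delta> (\<Union>j. S j) \<le> (\<Sum>j. hausdorff_pre k \<delta> (S j))"
    by (intro hausdorff_pre_UN_le) simp
  also have "\<dots> \<le> (\<Sum>j. hausdorff_measure k (S j))"
    using \<open>\<delta> \<in> {0<..}\<close> by (intro suminf_le hausdorff_pre_le_measure) auto
  finally show "hausdorff_pre k \<delta> (\<Union>j. S j) \<le> (\<Sum>j. hausdorff_measure k (S j))" .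
qed

lemma hausdorff_measure_mono:
  fixes S T :: "'a::metric_space set"
  assumes "S \<subseteq> T"
  shows "hausdorff_measure k S \<le> hausdorff_measure k T"
  unfolding hausdorff_measure_eq_SUP hausdorff_pre_def
proof (intro SUP_mono' mult_left_mono Inf_superset_mono Collect_mono impI)
  fix \<delta> y
  assume "\<exists>B. y = (\<Sum>j. ennreal (diam_pow k (B j))) \<and>
      (\<forall>j. bounded (B j) \<and> diameter (B j) \<le> \<delta>) \<and> T \<subseteq> (\<Union>j. B j)"
  then show "\<exists>B. y = (\<Sum>j. ennreal (diam_pow k (B j))) \<and>
      (\<forall>j. bounded (B j) \<and> diameter (B j) \<le> \<delta>) \<and> S \<subseteq> (\<Union>j. B j)"
    using assms by (elim ex_forward) (blast dest: order_trans)
qed simp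

text \<open>
Images of covering sets under a map that does not increase distances cover the image and have no
larger diameters. Applied to isometries, this spares any discussion of how Lebesgue measure behaves
under rotations.
\<close>

lemma hausdorff_measure_short_map_le:
  fixes f :: "'a::metric_space \<Rightarrow> 'b::metric_space"
  assumes f: "\<And>x y. dist (f x) (f y) \<le> dist x y"
  shows "hausdorff_measure k (f ` S) \<le> hausdorff_measure k S"
proof -
  have diam: "bounded (f ` B)" "diameter (f ` B) \<le> diameter B" if "bounded B" for B
  proof -
    have "dist (f x) (f y) \<le> diameter B" if "x \<in> B" "y \<in> B" for x y
      using diameter_bounded_bound[OF \<open>bounded B\<close> that] f[of x y] by simp
    then have *: "\<And>x y. x \<in> f ` B \<Longrightarrow> y \<in> f ` B \<Longrightarrow> dist x y \<le> diameter B" by blast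
    show "bounded (f ` B)" unfolding bounded_two_points using * by blast
    show "diameter (f ` B) \<le> diameter B"
      using diameter_ge_0[OF that] *
      by (cases "B = {}") (auto simp: diameter_def intro!: cSUP_least)
  qed
  have "hausdorff_pre k \<delta> (f ` S) \<le> hausdorff_pre k \<delta> S" for \<delta>
    unfolding hausdorff_pre_def
  proof (intro mult_left_mono Inf_greatest, clarify)
    fix B :: "nat \<Rightarrow> 'a set"
    assume B: "\<forall>j. bounded (B j) \<and> diameter (B j) \<le> \<delta>" and S: "S \<subseteq> (\<Union>j. B j)"
    have "Inf {\<Sum>j. ennreal (diam_pow k (B j)) |B :: nat \<Rightarrow> 'b set.
        (\<forall>j. bounded (B j) \<and> diameter (B j) \<le> \<delta>) \<and> f ` S \<subseteq> (\<Union>j. B j)}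
      \<le> (\<Sum>j. ennreal (diam_pow k (f ` B j)))"
    proof (rule Inf_lower, intro CollectI exI[of _ "\<lambda>j. f ` B j"] conjI refl allI)
      fix j show "bounded (f ` B j)" "diameter (f ` B j) \<le> \<delta>"
        using B diam[of "B j"] by (auto intro: order_trans)
    qed (use S in blast)
    also have "\<dots> \<le> (\<Sum>j. ennreal (diam_pow k (B j)))"
      using B diam diameter_ge_0
      by (intro suminf_le ennreal_leI) (auto simp: diam_pow_def intro!: power_mono)
    finally show "Inf {\<Sum>j. ennreal (diam_pow k (B j)) |B :: nat \<Rightarrow> 'b set.
        (\<forall>j. bounded (B j) \<and> diameter (B j) \<le> \<delta>) \<and> f ` S \<subseteq> (\<Union>j. B j)}
      \<le> (\<Sum>j. ennreal (diam_pow k (B j)))" .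
  qed simp
  then show ?thesis
    unfolding hausdorff_measure_eq_SUP by (intro SUP_mono') auto
qed

section \<open>Comparison with Lebesgue measure\<close>

lemma nn_integral_count_space_Un_le:
  "(\<integral>\<^sup>+x. f x \<partial>count_space (A \<union> B)) \<le> (\<integral>\<^sup>+x. f x \<partial>count_space A) + (\<integral>\<^sup>+x. f x \<partial>count_space B)"
proof -
  have "(\<integral>\<^sup>+x. f x \<partial>count_space (A \<union> B)) = (\<integral>\<^sup>+x. f x * indicator (A \<union> B) x \<partial>count_space UNIV)"
    by (simp add: nn_integral_count_space_indicator)
  also have "\<dots> \<le> (\<integral>\<^sup>+x. f x * indicator A x + f x * indicator B x \<partial>count_space UNIV)"
    by (intro nn_integral_mono) (auto simp: indicator_def)
  also have "\<dots> = (\<integral>\<^sup>+x. f x * indicator A x \<partial>count_space UNIV)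
      + (\<integral>\<^sup>+x. f x * indicator B x \<partial>count_space UNIV)"
    by (rule nn_integral_add) auto
  finally show ?thesis by (simp add: nn_integral_count_space_indicator)
qed

text \<open>
The normalization \<open>\<omega>\<^sub>d / 2\<^sup>d\<close> is chosen so that a ball contributes exactly its volume to a cover.
\<close>

lemma diam_pow_ball:
  fixes a :: "'a::euclidean_space"
  assumes "0 < r"
  shows "ennreal (unit_ball_vol (real DIM('a)) / 2 ^ DIM('a)) * ennreal (diam_pow DIM('a) (ball a r))
    = emeasure lborel (ball a r)"
proof -
  have "diam_pow DIM('a) (ball a r) = (2 * r) ^ DIM('a)"
    using assms by (simp add: diam_pow_def)
  then show ?thesis
    using assms by (simp add: emeasure_ball ennreal_mult'[symmetric] power_mult_distrib)
qed

lemma sum_emeasure_disjoint_balls_le: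
  fixes U :: "'a::euclidean_space set"
  assumes "countable C" "pairwise (\<lambda>i j. disjnt (ball (a i) (r i)) (ball (a j) (r j))) C"
    and "\<And>i. i \<in> C \<Longrightarrow> ball (a i) (r i) \<subseteq> U" and "open U"
  shows "(\<integral>\<^sup>+i. emeasure lborel (ball (a i) (r i)) \<partial>count_space C) \<le> emeasure lborel U"
proof -
  have "disjoint_family_on (\<lambda>i. ball (a i) (r i)) C"
    using assms(2) by (auto simp: disjoint_family_on_def pairwise_def disjnt_def)
  then have "(\<integral>\<^sup>+i. emeasure lborel (ball (a i) (r i)) \<partial>count_space C)
      = emeasure lborel (\<Union>i\<in>C. ball (a i) (r i))"
    using assms(1) by (intro emeasure_UN_countable[symmetric]) auto
  also have "\<dots> \<le> emeasure lborel U"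
    using assms by (intro emeasure_mono) auto
  finally show ?thesis .
qed

lemma negligible_outer_open:
  fixes N :: "'a::euclidean_space set"
  assumes "negligible N" "0 < e"
  obtains V where "open V" "N \<subseteq> V" "emeasure lborel V < ennreal e"
proof -
  obtain V where V: "open V" "N \<subseteq> V" "emeasure lebesgue (V - N) < ennreal e"
    by (rule sets_lebesgue_outer_open[OF negligible_imp_sets[OF assms(1)] assms(2)])
  have "emeasure lborel V = emeasure lebesgue V"
    using V(1) by simp
  also have "\<dots> = emeasure lebesgue (V - N)"
    using assms(1) V(1) by (intro emeasure_Diff_null_set[symmetric]) (auto simp: negligible_iff_null_sets)
  finally show thesis using V that by simp
qed

text \<open>
By Vitali's covering theorem an open set is, up to a null set, a disjoint union of balls of small
radius, and these contribute at most its volume. The remaining null set lies in an open set of small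
volume; there the cruder covering lemma, which enlarges disjoint balls by the factor 5, gives a full
cover whose contribution is at most \<open>5\<^sup>d\<close> times that small volume.
\<close>

lemma hausdorff_pre_le_emeasure_open:
  fixes U :: "'a::euclidean_space set"
  assumes "open U" "S \<subseteq> U" "0 < \<delta>"
  shows "hausdorff_pre DIM('a) \<delta> S \<le> emeasure lborel U"
proof (rule ennreal_le_epsilon)
  fix e :: real assume "0 < e"
  define c where "c = ennreal (unit_ball_vol (real DIM('a)) / 2 ^ DIM('a))"
  define K where "K W \<eta> = {(a::'a, r). 0 < r \<and> r \<le> \<eta> \<and> ball a r \<subseteq> W}" for W and \<eta> :: real
  have "\<exists>i. i \<in> K U (\<delta>/2) \<and> x \<in> ball (fst i) (snd i) \<and> snd i < d" if "x \<in> U" "0 < d" for x d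
  proof -
    obtain r where "0 < r" "ball x r \<subseteq> U" using assms(1) \<open>x \<in> U\<close> by (meson openE)
    then have "(x, min r (min (\<delta>/2) (d/2))) \<in> K U (\<delta>/2)"
      using \<open>0 < d\<close> assms(3) by (auto simp: K_def)
    then show ?thesis using \<open>0 < r\<close> \<open>0 < d\<close> assms(3) by force
  qed
  then obtain C where C: "countable C" "C \<subseteq> K U (\<delta>/2)"
    "pairwise (\<lambda>i j. disjnt (ball (fst i) (snd i)) (ball (fst j) (snd j))) C"
    and N: "negligible (U - (\<Union>i\<in>C. ball (fst i) (snd i)))"
    by (rule Vitali_covering_theorem_balls[where a = fst and r = snd])
  \<comment> \<open>The factor \<open>5\<^sup>d\<close> pays for the fivefold enlargement of the balls that cover the null set.\<close>
  obtain V where V: "open V" "U - (\<Union>i\<in>C. ball (fst i) (snd i)) \<subseteq> V"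
    "emeasure lborel V < ennreal (e / 5 ^ DIM('a))"
    using negligible_outer_open[OF N, of "e / 5 ^ DIM('a)"] \<open>0 < e\<close> by auto
  have cov: "V \<subseteq> (\<Union>i\<in>K V (\<delta>/10). ball (fst i) (snd i))"
  proof
    fix x assume "x \<in> V"
    then obtain r where "0 < r" "ball x r \<subseteq> V" using V(1) by (meson openE)
    then have "(x, min r (\<delta>/10)) \<in> K V (\<delta>/10)"
      using assms(3) by (auto simp: K_def)
    then show "x \<in> (\<Union>i\<in>K V (\<delta>/10). ball (fst i) (snd i))"
      using \<open>0 < r\<close> assms(3) by force
  qed
  have rad: "0 < snd i \<and> snd i \<le> \<delta>/10" if "i \<in> K V (\<delta>/10)" for i
    using that by (auto simp: K_def)
  obtain C' where C': "countable C'" "C' \<subseteq> K V (\<delta>/10)"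
    "pairwise (\<lambda>i j. disjnt (ball (fst i) (snd i)) (ball (fst j) (snd j))) C'"
    "V \<subseteq> (\<Union>i\<in>C'. ball (fst i) (5 * snd i))"
    by (rule Vitali_covering_lemma_balls[OF cov rad])
  define D where "D = (\<lambda>(a, r). (a, 5 * r)) ` C'"
  define b where "b i = ball (fst i) (snd i)" for i :: "'a \<times> real"
  have C_K: "0 < snd i" "snd i \<le> \<delta>/2" "b i \<subseteq> U" if "i \<in> C" for i
    using subsetD[OF C(2) that] by (auto simp: K_def b_def split_beta)
  have C'_K: "0 < snd i" "snd i \<le> \<delta>/10" "b i \<subseteq> V" if "i \<in> C'" for i
    using subsetD[OF C'(2) that] by (auto simp: K_def b_def split_beta)
  have C_sum: "c * (\<integral>\<^sup>+i. ennreal (diam_pow DIM('a) (b i)) \<partial>count_space C) \<le> emeasure lborel U"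
  proof -
    have "c * (\<integral>\<^sup>+i. ennreal (diam_pow DIM('a) (b i)) \<partial>count_space C)
        = (\<integral>\<^sup>+i. emeasure lborel (b i) \<partial>count_space C)"
    proof (subst nn_integral_cmult[symmetric], simp, rule nn_integral_cong)
      fix i assume "i \<in> space (count_space C)"
      then show "c * ennreal (diam_pow DIM('a) (b i)) = emeasure lborel (b i)"
        unfolding c_def b_def using C_K(1) by (intro diam_pow_ball) simp
    qed
    also have "\<dots> \<le> emeasure lborel U"
      unfolding b_def
      by (rule sum_emeasure_disjoint_balls_le) (use C assms(1) C_K(3) in \<open>auto simp: b_def\<close>)
    finally show ?thesis .
  qed
  have D_sum: "c * (\<integral>\<^sup>+i. ennreal (diam_pow DIM('a) (b i)) \<partial>count_space D) \<le> ennreal e"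
  proof -
    have bij: "bij_betw (\<lambda>(a, r). (a, 5 * r)) C' D"
      unfolding D_def by (rule inj_on_imp_bij_betw) (auto simp: inj_on_def)
    have "c * (\<integral>\<^sup>+i. ennreal (diam_pow DIM('a) (b i)) \<partial>count_space D)
        = c * (\<integral>\<^sup>+i. ennreal (diam_pow DIM('a) (b ((\<lambda>(a, r). (a, 5 * r)) i))) \<partial>count_space C')"
      by (subst nn_integral_bij_count_space[OF bij]) simp
    also have "\<dots> = (\<integral>\<^sup>+i. ennreal (5 ^ DIM('a)) * emeasure lborel (b i) \<partial>count_space C')"
    proof (subst nn_integral_cmult[symmetric], simp, rule nn_integral_cong)
      fix i assume "i \<in> space (count_space C')"
      then have "0 < snd i" using C'_K by simp
      then have "c * ennreal (diam_pow DIM('a) (ball (fst i) (5 * snd i)))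
          = ennreal (5 ^ DIM('a)) * emeasure lborel (b i)"
        unfolding c_def
        by (subst diam_pow_ball)
          (simp_all add: b_def emeasure_ball ennreal_mult'[symmetric] power_mult_distrib mult_ac)
      then show "c * ennreal (diam_pow DIM('a) (b (case i of (a, r) \<Rightarrow> (a, 5 * r))))
          = ennreal (5 ^ DIM('a)) * emeasure lborel (b i)"
        by (simp add: b_def split_beta)
    qed
    also have "\<dots> = ennreal (5 ^ DIM('a)) * (\<integral>\<^sup>+i. emeasure lborel (b i) \<partial>count_space C')"
      by (rule nn_integral_cmult) simp
    also have "\<dots> \<le> ennreal (5 ^ DIM('a)) * emeasure lborel V"
      unfolding b_def
      by (intro mult_left_mono sum_emeasure_disjoint_balls_le)
        (use C' V(1) C'_K(3) in \<open>auto simp: b_def\<close>)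
    also have "\<dots> \<le> ennreal (5 ^ DIM('a)) * ennreal (e / 5 ^ DIM('a))"
      using V(3) by (intro mult_left_mono) auto
    also have "\<dots> = ennreal e"
      using \<open>0 < e\<close> by (simp add: ennreal_mult'[symmetric])
    finally show ?thesis .
  qed
  have "hausdorff_pre DIM('a) \<delta> S
      \<le> c * (\<integral>\<^sup>+i. ennreal (diam_pow DIM('a) (b i)) \<partial>count_space (C \<union> D))"
    unfolding c_def
  proof (rule hausdorff_pre_le_countable_cover)
    show "countable (C \<union> D)" using C(1) C'(1) by (simp add: D_def)
    show "S \<subseteq> (\<Union>i\<in>C \<union> D. b i)"
    proof
      fix x assume "x \<in> S"
      then have "x \<in> (\<Union>i\<in>C. b i) \<or> x \<in> V" using assms(2) V(2) unfolding b_def by blast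
      moreover have "V \<subseteq> (\<Union>i\<in>D. b i)"
        using C'(4) by (auto simp: D_def b_def split_beta)
      ultimately show "x \<in> (\<Union>i\<in>C \<union> D. b i)" by blast
    qed
    show "0 \<le> \<delta>" using assms(3) by simp
    fix i assume "i \<in> C \<union> D"
    then have "0 < snd i \<and> snd i \<le> \<delta> / 2"
    proof
      assume "i \<in> C"
      then show ?thesis using C_K by simp
    next
      assume "i \<in> D"
      then obtain j where "j \<in> C'" "snd i = 5 * snd j" by (auto simp: D_def split_beta)
      then show ?thesis using C'_K[of j] by simp
    qed
    then show "bounded (b i) \<and> diameter (b i) \<le> \<delta>" by (simp add: b_def)
  qed
  also have "\<dots> \<le> c * ((\<integral>\<^sup>+i. ennreal (diam_pow DIM('a) (b i)) \<partial>count_space C)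
      + (\<integral>\<^sup>+i. ennreal (diam_pow DIM('a) (b i)) \<partial>count_space D))"
    by (intro mult_left_mono nn_integral_count_space_Un_le) simp
  also have "\<dots> \<le> emeasure lborel U + ennreal e"
    unfolding distrib_left by (rule add_mono[OF C_sum D_sum])
  finally show "hausdorff_pre DIM('a) \<delta> S \<le> emeasure lborel U + ennreal e" .
qed

text \<open>
Lebesgue measure is outer regular, so the bound for open sets carries over.
\<close>

lemma hausdorff_measure_le_lebesgue:
  fixes S :: "'a::euclidean_space set"
  assumes "S \<in> sets lebesgue"
  shows "hausdorff_measure DIM('a) S \<le> emeasure lebesgue S"
  unfolding hausdorff_measure_eq_SUP
proof (rule SUP_least, rule ennreal_le_epsilon)
  fix \<delta> e :: real assume "\<delta> \<in> {0<..}" "0 < e"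
  obtain U where U: "open U" "S \<subseteq> U" "U - S \<in> lmeasurable" "emeasure lebesgue (U - S) < ennreal e"
    by (rule sets_lebesgue_outer_open[OF assms \<open>0 < e\<close>])
  have "hausdorff_pre DIM('a) \<delta> S \<le> emeasure lborel U"
    using U(1,2) \<open>\<delta> \<in> {0<..}\<close>
    by (intro hausdorff_pre_le_emeasure_open) simp_all
  also have "\<dots> = emeasure lebesgue (S \<union> (U - S))"
  proof -
    have "S \<union> (U - S) = U" using U(2) by blast
    then show ?thesis using U(1) by simp
  qed
  also have "\<dots> \<le> emeasure lebesgue S + emeasure lebesgue (U - S)"
    using assms fmeasurableD[OF U(3)] by (intro emeasure_subadditive)
  also have "\<dots> \<le> emeasure lebesgue S + ennreal e"
    by (intro add_left_mono less_imp_le U(4))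
  finally show "hausdorff_pre DIM('a) \<delta> S \<le> emeasure lebesgue S + ennreal e" .
qed

section \<open>Jung's theorem\<close>

text \<open>
With \<open>c = \<Sum> u\<^sub>x x\<close> and all \<open>x\<close> at squared distance \<open>R\<close> from \<open>c\<close>, expanding \<open>|x - y|\<^sup>2\<close> about \<open>c\<close> gives
\<open>\<Sum> u\<^sub>x |x - y|\<^sup>2 = 2 R\<close> for every \<open>y\<close> in the set, because the weighted deviations from \<open>c\<close> cancel. The
term \<open>x = y\<close> vanishes, so the left-hand side is at most \<open>(1 - u\<^sub>y) D\<close>; now sum over \<open>y\<close>.
\<close>

lemma jung_caratheodory_bound:
  fixes c :: "'a::euclidean_space"
  assumes "finite S" "S \<noteq> {}" "c \<in> convex hull S"
    and R: "\<And>x. x \<in> S \<Longrightarrow> (norm (x - c))\<^sup>2 = R"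
    and D: "\<And>x y. x \<in> S \<Longrightarrow> y \<in> S \<Longrightarrow> (norm (x - y))\<^sup>2 \<le> D"
  shows "2 * real (card S) * R \<le> (real (card S) - 1) * D"
proof -
  obtain u where u: "\<And>x. x \<in> S \<Longrightarrow> 0 \<le> u x" "sum u S = 1" "(\<Sum>x\<in>S. u x *\<^sub>R x) = c"
    using assms(1,3) by (auto simp: convex_hull_finite)
  have cent: "(\<Sum>x\<in>S. u x *\<^sub>R (x - c)) = 0"
    using u by (simp add: scaleR_diff_right sum_subtractf scaleR_left.sum[symmetric])
  have *: "2 * R \<le> (1 - u y) * D" if y: "y \<in> S" for y
  proof -
    have "(\<Sum>x\<in>S. u x * (norm (x - y))\<^sup>2)
        = (\<Sum>x\<in>S. u x * (2 * R) - 2 * ((u x *\<^sub>R (x - c)) \<bullet> (y - c)))"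
    proof (rule sum.cong)
      fix x assume "x \<in> S"
      have "(norm (x - y))\<^sup>2 = (norm ((x - c) - (y - c)))\<^sup>2" by simp
      also have "\<dots> = (norm (x - c))\<^sup>2 + (norm (y - c))\<^sup>2 - 2 * ((x - c) \<bullet> (y - c))"
        by (simp add: power2_norm_eq_inner inner_commute inner_diff)
      finally have "(norm (x - y))\<^sup>2 = 2 * R - 2 * ((x - c) \<bullet> (y - c))"
        using R[OF \<open>x \<in> S\<close>] R[OF y] by simp
      then show "u x * (norm (x - y))\<^sup>2 = u x * (2 * R) - 2 * ((u x *\<^sub>R (x - c)) \<bullet> (y - c))"
        by (simp only: inner_scaleR_left) (simp add: right_diff_distrib mult_ac)
    qed simp
    also have "\<dots> = (\<Sum>x\<in>S. u x) * (2 * R) - 2 * ((\<Sum>x\<in>S. u x *\<^sub>R (x - c)) \<bullet> (y - c))"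
      by (simp add: sum_subtractf sum_distrib_right inner_sum_left sum_distrib_left)
    also have "\<dots> = 2 * R" using cent u(2) by simp
    finally have "2 * R = (\<Sum>x\<in>S. u x * (norm (x - y))\<^sup>2)" ..
    also have "\<dots> = (\<Sum>x\<in>S - {y}. u x * (norm (x - y))\<^sup>2)"
      using assms(1) y by (simp add: sum.remove)
    also have "\<dots> \<le> (\<Sum>x\<in>S - {y}. u x * D)"
      using u(1) D y by (intro sum_mono mult_left_mono) auto
    also have "\<dots> = (1 - u y) * D"
      using assms(1) y u(2) by (simp add: sum_distrib_right[symmetric] sum_diff1)
    finally show ?thesis .
  qed
  have "(\<Sum>y\<in>S. 2 * R) \<le> (\<Sum>y\<in>S. (1 - u y) * D)"
    by (rule sum_mono) (rule *)
  also have "\<dots> = (real (card S) - 1) * D"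
    using u(2) by (simp add: sum_distrib_right[symmetric] sum_subtractf)
  finally show ?thesis by (simp add: mult_ac)
qed

text \<open>
A compact set has an enclosing ball whose centre is a convex combination of points of the set that
lie on the sphere. The centre is found by maximizing the variance \<open>E |x|\<^sup>2 - |E x|\<^sup>2\<close> over the convex
combinations of points of \<open>X\<close>, that is, by maximizing \<open>t - |p|\<^sup>2\<close> over the points \<open>(p, t)\<close> of the convex
hull of the lifted set \<open>{(x, |x|\<^sup>2)}\<close>. Mixing a little of \<open>x \<in> X\<close> into the maximizer cannot increase
the variance, and this says that \<open>x\<close> lies in the ball whose squared radius \<open>R\<close> is the maximal
variance. Since \<open>R\<close> is also the average of the squared distances to the centre, all points of
positive weight lie on the sphere.
\<close>

lemma compact_circumcentre:
  fixes X :: "'a::euclidean_space set"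
  assumes "compact X" "X \<noteq> {}"
  obtains c R where "\<And>x. x \<in> X \<Longrightarrow> (norm (x - c))\<^sup>2 \<le> R"
    and "c \<in> convex hull {x \<in> X. (norm (x - c))\<^sup>2 = R}"
proof -
  define L where "L x = (x, (norm x)\<^sup>2)" for x :: 'a
  define H where "H = convex hull (L ` X)"
  have "continuous_on X L" unfolding L_def by (intro continuous_intros)
  then have "compact H"
    unfolding H_def using assms(1) by (intro compact_convex_hull compact_continuous_image)
  moreover have "H \<noteq> {}" using assms(2) by (simp add: H_def)
  moreover have "continuous_on H (\<lambda>p. snd p - (norm (fst p))\<^sup>2)" by (intro continuous_intros)
  ultimately obtain p where p: "p \<in> H"
    "\<And>q. q \<in> H \<Longrightarrow> snd q - (norm (fst q))\<^sup>2 \<le> snd p - (norm (fst p))\<^sup>2"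
    using continuous_attains_sup[of H "\<lambda>p. snd p - (norm (fst p))\<^sup>2"] by blast
  define c t where "c = fst p" and "t = snd p"
  define R where "R = t - (norm c)\<^sup>2"
  have pct: "p = (c, t)" by (simp add: c_def t_def)
  \<comment> \<open>First-order optimality: a step of size \<open>s\<close> from \<open>p\<close> towards the lifted point of \<open>x\<close> changes the
    variance by \<open>s ((1 - s) |x - c|\<^sup>2 - R)\<close>.\<close>
  have bound: "(norm (x - c))\<^sup>2 \<le> R" if "x \<in> X" for x
  proof (rule field_le_epsilon)
    fix e :: real assume "0 < e"
    define v where "v = (norm (x - c))\<^sup>2"
    define s where "s = min 1 (e / (v + 1))"
    have v: "0 \<le> v" by (simp add: v_def)
    have s: "0 < s" "s \<le> 1" using \<open>0 < e\<close> v by (auto simp: s_def)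
    have "s * v \<le> e / (v + 1) * v" using v by (intro mult_right_mono) (auto simp: s_def)
    also have "\<dots> \<le> e" using v \<open>0 < e\<close> by (simp add: field_simps)
    finally have sv: "s * v \<le> e" .
    have "(1 - s) *\<^sub>R p + s *\<^sub>R L x \<in> H"
      using p(1) s \<open>x \<in> X\<close> hull_inc[of "L x" "L ` X" convex]
      by (intro convexD[OF convex_convex_hull[of "L ` X", folded H_def]]) (auto simp: H_def)
    from p(2)[OF this]
    have "(1 - s) * t + s * (norm x)\<^sup>2 - (norm ((1 - s) *\<^sub>R c + s *\<^sub>R x))\<^sup>2 \<le> R"
      by (simp add: L_def pct R_def)
    also have "(norm ((1 - s) *\<^sub>R c + s *\<^sub>R x))\<^sup>2
        = (1 - s) * (norm c)\<^sup>2 + s * (norm x)\<^sup>2 - s * (1 - s) * v"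
      by (simp add: v_def power2_norm_eq_inner inner_commute inner_simps algebra_simps)
    finally have "s * ((1 - s) * v) \<le> s * R" by (simp add: R_def algebra_simps)
    then have "(1 - s) * v \<le> R" using s by simp
    with sv show "(norm (x - c))\<^sup>2 \<le> R + e" by (simp add: v_def algebra_simps)
  qed
  obtain S u where S: "finite S" "S \<subseteq> L ` X" "\<And>q. q \<in> S \<Longrightarrow> 0 \<le> u q" "sum u S = 1"
    "(\<Sum>q\<in>S. u q *\<^sub>R q) = p"
    using p(1) unfolding H_def convex_hull_explicit by blast
  have Sc: "(\<Sum>q\<in>S. u q *\<^sub>R fst q) = c" and St: "(\<Sum>q\<in>S. u q * snd q) = t"
    using arg_cong[OF S(5), of fst] arg_cong[OF S(5), of snd] by (simp_all add: fst_sum snd_sum c_def t_def)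
  have sndS: "snd q = (norm (fst q))\<^sup>2" "fst q \<in> X" if "q \<in> S" for q
    using S(2) that by (auto simp: L_def)
  \<comment> \<open>The average of the nonnegative numbers \<open>R - |x - c|\<^sup>2\<close> is zero, so each that counts is zero.\<close>
  have "(\<Sum>q\<in>S. u q * (R - (norm (fst q - c))\<^sup>2))
      = (\<Sum>q\<in>S. u q * R - u q * snd q + 2 * ((u q *\<^sub>R fst q) \<bullet> c) - u q * (norm c)\<^sup>2)"
    by (intro sum.cong refl)
      (simp add: sndS power2_norm_eq_inner inner_commute inner_simps algebra_simps)
  also have "\<dots> = sum u S * R - t + 2 * (c \<bullet> c) - sum u S * (norm c)\<^sup>2"
    by (simp add: sum_subtractf sum.distrib sum_distrib_right[symmetric] sum_distrib_left[symmetric]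
        inner_sum_left[symmetric] St Sc del: inner_scaleR_left)
  also have "\<dots> = 0" by (simp add: S(4) R_def power2_norm_eq_inner)
  finally have zero: "(\<Sum>q\<in>S. u q * (R - (norm (fst q - c))\<^sup>2)) = 0" .
  have "\<forall>q\<in>S. u q * (R - (norm (fst q - c))\<^sup>2) = 0"
    using zero S(1,3) bound sndS(2) by (subst (asm) sum_nonneg_eq_0_iff) auto
  then have contact: "(norm (fst q - c))\<^sup>2 = R" if "q \<in> S" "u q \<noteq> 0" for q
    using that by auto
  have "(\<Sum>q\<in>{q\<in>S. u q \<noteq> 0}. u q *\<^sub>R fst q) \<in> convex hull {x \<in> X. (norm (x - c))\<^sup>2 = R}"
  proof (rule convex_sum[OF _ convex_convex_hull])
    show "sum u {q \<in> S. u q \<noteq> 0} = 1"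
      using S(1,4) by (subst sum.mono_neutral_cong_left[of S _ u u]) auto
  qed (use S contact sndS in \<open>auto intro!: hull_inc\<close>)
  also have "(\<Sum>q\<in>{q\<in>S. u q \<noteq> 0}. u q *\<^sub>R fst q) = c"
    using Sc S(1) by (subst sum.mono_neutral_cong_left[of S]) auto
  finally have "c \<in> convex hull {x \<in> X. (norm (x - c))\<^sup>2 = R}" .
  with bound that show thesis by blast
qed

text \<open>
Jung's theorem. By Caratheodory's theorem the circumcentre is a convex combination of at most
\<open>d + 1\<close> points on the sphere, and \<open>(n - 1) / (2 n)\<close> increases with the number \<open>n\<close> of points.
\<close>

lemma jung:
  fixes X :: "'a::euclidean_space set"
  assumes "bounded X"
  obtains c where "X \<subseteq> cball c (sqrt (real DIM('a) / (2 * (real DIM('a) + 1))) * diameter X)"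
proof (cases "X = {}")
  case False
  define d where "d = real DIM('a)"
  have "compact (closure X)" "closure X \<noteq> {}" using assms False by auto
  then obtain c R where R: "\<And>x. x \<in> closure X \<Longrightarrow> (norm (x - c))\<^sup>2 \<le> R"
    and c: "c \<in> convex hull {x \<in> closure X. (norm (x - c))\<^sup>2 = R}"
    using compact_circumcentre by blast
  obtain S where S: "finite S" "S \<subseteq> {x \<in> closure X. (norm (x - c))\<^sup>2 = R}"
    "card S \<le> DIM('a) + 1" "c \<in> convex hull S"
    using c caratheodory[of "{x \<in> closure X. (norm (x - c))\<^sup>2 = R}"] by blast
  have "S \<noteq> {}" using S(4) by auto
  define n where "n = real (card S)"
  have n: "1 \<le> n" "n \<le> d + 1"
    using \<open>S \<noteq> {}\<close> S(1,3) by (auto simp: n_def d_def Suc_le_eq card_gt_0_iff)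
  have "(norm (x - y))\<^sup>2 \<le> (diameter X)\<^sup>2" if "x \<in> S" "y \<in> S" for x y
    using diameter_bounded_bound[of "closure X" x y] that S(2) assms
    by (intro power_mono) (auto simp: dist_norm diameter_closure)
  then have nR: "2 * n * R \<le> (n - 1) * (diameter X)\<^sup>2"
    unfolding n_def by (intro jung_caratheodory_bound[OF S(1) \<open>S \<noteq> {}\<close> S(4)]) (use S(2) in auto)
  have "R \<le> (n - 1) / (2 * n) * (diameter X)\<^sup>2"
    using nR n by (simp add: field_simps)
  also have "\<dots> \<le> d / (2 * (d + 1)) * (diameter X)\<^sup>2"
    using n by (intro mult_right_mono) (auto simp: field_simps)
  finally have R': "R \<le> d / (2 * (d + 1)) * (diameter X)\<^sup>2" .
  have "X \<subseteq> cball c (sqrt (d / (2 * (d + 1))) * diameter X)"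
  proof
    fix x assume "x \<in> X"
    then have "(norm (x - c))\<^sup>2 \<le> d / (2 * (d + 1)) * (diameter X)\<^sup>2"
      using R R' closure_subset by fastforce
    then have "norm (x - c) \<le> sqrt (d / (2 * (d + 1)) * (diameter X)\<^sup>2)"
      by (rule real_le_rsqrt)
    also have "\<dots> = sqrt (d / (2 * (d + 1))) * diameter X"
      unfolding real_sqrt_mult using diameter_ge_0[OF assms] by simp
    finally show "x \<in> cball c (sqrt (d / (2 * (d + 1))) * diameter X)"
      by (simp add: dist_norm norm_minus_commute)
  qed
  then show thesis using that by (simp add: d_def)
qed (use that in auto)

section \<open>Volumes of cylinders\<close>

text \<open>
The case \<open>r = 0\<close> matters for covering sets that consist of a single point; it follows from positive
radii by continuity, with \<open>0\<^sup>0 = 1\<close> in dimension zero.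
\<close>

lemma emeasure_cball_coordinates_le:
  fixes r :: real
  assumes "finite A" "0 \<le> r"
  shows "emeasure (Pi\<^sub>M A (\<lambda>_. lborel))
      ({f. sqrt (\<Sum>i\<in>A. (f i)\<^sup>2) \<le> r} \<inter> space (Pi\<^sub>M A (\<lambda>_. lborel)))
    \<le> ennreal (unit_ball_vol (real (card A)) * r ^ card A)"
proof -
  let ?V = "\<lambda>r. {f. sqrt (\<Sum>i\<in>A. (f i)\<^sup>2) \<le> r} \<inter> space (Pi\<^sub>M A (\<lambda>_. lborel))"
  have "((\<lambda>e. ennreal (unit_ball_vol (real (card A)) * e ^ card A))
      \<longlongrightarrow> ennreal (unit_ball_vol (real (card A)) * r ^ card A)) (at_right r)"
    by (intro tendsto_intros)
  moreover have "\<forall>\<^sub>F e in at_right r. emeasure (Pi\<^sub>M A (\<lambda>_. lborel)) (?V r)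
      \<le> ennreal (unit_ball_vol (real (card A)) * e ^ card A)"
    using eventually_at_right_less
  proof eventually_elim
    case (elim e)
    have "emeasure (Pi\<^sub>M A (\<lambda>_. lborel)) (?V r) \<le> emeasure (Pi\<^sub>M A (\<lambda>_. lborel)) (?V e)"
      using elim assms(1) by (intro emeasure_mono) (auto, measurable)
    also have "\<dots> = ennreal (unit_ball_vol (real (card A)) * e ^ card A)"
      using elim assms by (intro emeasure_cball_aux) auto
    finally show ?case .
  qed
  ultimately show ?thesis
    by (rule tendsto_lowerbound) simp
qed

text \<open>
Fubini's theorem for the product measure on coordinates: the coordinate along \<open>b\<close> ranges over an
interval and the others over a ball of one dimension less.
\<close>

lemma emeasure_axis_cylinder_le:
  fixes b :: "'a::euclidean_space" and r :: real
  assumes "b \<in> Basis" "0 \<le> r" "l \<le> u"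
  shows "emeasure lborel {x. x \<bullet> b \<in> {l..u} \<and> norm (x - (x \<bullet> b) *\<^sub>R b) \<le> r}
    \<le> ennreal (unit_ball_vol (real (DIM('a) - 1)) * r ^ (DIM('a) - 1) * (u - l))"
proof -
  interpret product_sigma_finite "\<lambda>_::'a. lborel :: real measure" by standard
  define A where "A = (Basis :: 'a set) - {b}"
  have A: "finite A" "b \<notin> A" "insert b A = Basis" "card A = DIM('a) - 1"
    using assms(1) by (auto simp: A_def)
  define V where "V = {f. sqrt (\<Sum>i\<in>A. (f i)\<^sup>2) \<le> r} \<inter> space (Pi\<^sub>M A (\<lambda>_. lborel :: real measure))"
  define Cyl where "Cyl = {x. x \<bullet> b \<in> {l..u} \<and> norm (x - (x \<bullet> b) *\<^sub>R b) \<le> r}"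
  define T where "T f = (\<Sum>i\<in>Basis. f i *\<^sub>R i)" for f :: "'a \<Rightarrow> real"
  have T_inner: "T f \<bullet> i = f i" if "i \<in> Basis" for f i
    using that by (simp add: T_def)
  have norm_T: "norm (T f - (T f \<bullet> b) *\<^sub>R b) = sqrt (\<Sum>i\<in>A. (f i)\<^sup>2)" for f
  proof -
    have "norm (T f - (T f \<bullet> b) *\<^sub>R b)
        = sqrt (\<Sum>i\<in>Basis. ((T f - (T f \<bullet> b) *\<^sub>R b) \<bullet> i)\<^sup>2)"
      unfolding norm_eq_sqrt_inner by (subst euclidean_inner) (simp add: power2_eq_square)
    also have "(\<Sum>i\<in>Basis. ((T f - (T f \<bullet> b) *\<^sub>R b) \<bullet> i)\<^sup>2) = (\<Sum>i\<in>A. (f i)\<^sup>2)"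
      using assms(1) unfolding sum.remove[OF finite_Basis assms(1)] A_def
      by (auto simp: T_inner inner_diff_left inner_Basis intro!: sum.cong split: if_splits)
    finally show ?thesis .
  qed
  have closed: "closed Cyl"
  proof -
    have "Cyl = {x. l \<le> x \<bullet> b} \<inter> {x. x \<bullet> b \<le> u} \<inter> {x. norm (x - (x \<bullet> b) *\<^sub>R b) \<le> r}"
      by (auto simp: Cyl_def)
    also have "closed \<dots>" by (intro closed_Int closed_Collect_le continuous_intros)
    finally show ?thesis .
  qed
  have [measurable]: "V \<in> sets (Pi\<^sub>M A (\<lambda>_. lborel))"
    unfolding V_def using A(1) by measurable
  have T[measurable]: "T \<in> measurable (Pi\<^sub>M Basis (\<lambda>_. lborel)) borel"
    unfolding T_def by measurable
  have TC: "T -` Cyl \<inter> space (Pi\<^sub>M Basis (\<lambda>_. lborel)) \<in> sets (Pi\<^sub>M Basis (\<lambda>_. lborel))"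
    using closed by (intro measurable_sets[OF T]) simp
  have "emeasure lborel Cyl = emeasure (Pi\<^sub>M Basis (\<lambda>_. lborel))
      (T -` Cyl \<inter> space (Pi\<^sub>M Basis (\<lambda>_. lborel)))"
    using closed unfolding T_def by (subst lborel_eq, subst emeasure_distr) auto
  also have "\<dots> = (\<integral>\<^sup>+f. indicator (T -` Cyl \<inter> space (Pi\<^sub>M Basis (\<lambda>_. lborel))) f
      \<partial>Pi\<^sub>M (insert b A) (\<lambda>_. lborel))"
    using TC A(3) by simp
  also have "\<dots> = (\<integral>\<^sup>+f. (\<integral>\<^sup>+y. indicator (T -` Cyl \<inter> space (Pi\<^sub>M Basis (\<lambda>_. lborel))) (f(b := y))
      \<partial>lborel) \<partial>Pi\<^sub>M A (\<lambda>_. lborel))"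
    by (intro product_nn_integral_insert A(1,2)) (simp only: A(3) borel_measurable_indicator TC)
  also have "\<dots> = (\<integral>\<^sup>+f. (\<integral>\<^sup>+y. indicator V f * indicator {l..u} y \<partial>lborel) \<partial>Pi\<^sub>M A (\<lambda>_. lborel))"
  proof (intro nn_integral_cong)
    fix f :: "'a \<Rightarrow> real" and y :: real assume f: "f \<in> space (Pi\<^sub>M A (\<lambda>_. lborel))"
    then have sp: "f(b := y) \<in> space (Pi\<^sub>M Basis (\<lambda>_. lborel))"
      using assms(1) by (auto simp: space_PiM PiE_def extensional_def A_def)
    have "(\<Sum>i\<in>A. ((f(b := y)) i)\<^sup>2) = (\<Sum>i\<in>A. (f i)\<^sup>2)"
      using A(2) by (intro sum.cong) auto
    then have "norm (T (f(b := y)) - y *\<^sub>R b) = sqrt (\<Sum>i\<in>A. (f i)\<^sup>2)"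
      using norm_T[of "f(b := y)"] T_inner[OF assms(1), of "f(b := y)"] by simp
    then have iff: "f(b := y) \<in> T -` Cyl \<inter> space (Pi\<^sub>M Basis (\<lambda>_. lborel)) \<longleftrightarrow> f \<in> V \<and> y \<in> {l..u}"
      using f sp T_inner[OF assms(1), of "f(b := y)"] by (auto simp: Cyl_def V_def)
    show "(indicator (T -` Cyl \<inter> space (Pi\<^sub>M Basis (\<lambda>_. lborel))) (f(b := y)) :: ennreal)
        = indicator V f * indicator {l..u} y"
      unfolding indicator_def iff by simp
  qed
  also have "\<dots> = (\<integral>\<^sup>+f. indicator V f * ennreal (u - l) \<partial>Pi\<^sub>M A (\<lambda>_. lborel))"
    using assms(3) by (intro nn_integral_cong) (simp add: nn_integral_cmult)
  also have "\<dots> = emeasure (Pi\<^sub>M A (\<lambda>_. lborel)) V * ennreal (u - l)"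
    by (simp add: nn_integral_multc)
  also have "\<dots> \<le> ennreal (unit_ball_vol (real (DIM('a) - 1)) * r ^ (DIM('a) - 1)) * ennreal (u - l)"
    using emeasure_cball_coordinates_le[OF A(1) assms(2)] A(4)
    by (intro mult_right_mono) (auto simp: V_def)
  also have "\<dots> = ennreal (unit_ball_vol (real (DIM('a) - 1)) * r ^ (DIM('a) - 1) * (u - l))"
    using assms by (simp add: ennreal_mult)
  finally show ?thesis by (simp add: Cyl_def)
qed

text \<open>
An arbitrary cylinder is an isometric image of one along a coordinate axis.
\<close>

lemma hausdorff_measure_cylinder_le:
  fixes c e :: "real ^ 'n" and r :: real
  assumes "norm e = 1" "0 \<le> r" "l \<le> u"
  shows "hausdorff_measure CARD('n)
      {x. (x - c) \<bullet> e \<in> {l..u} \<and> norm ((x - c) - ((x - c) \<bullet> e) *\<^sub>R e) \<le> r}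
    \<le> ennreal (unit_ball_vol (real (CARD('n) - 1)) * r ^ (CARD('n) - 1) * (u - l))"
    (is "hausdorff_measure _ ?Cyl \<le> _")
proof -
  define b :: "real ^ 'n" where "b = axis undefined 1"
  have b: "b \<in> Basis" "norm b = 1" by (auto simp: b_def Basis_vec_def)
  obtain f :: "real ^ 'n \<Rightarrow> real ^ 'n" where f: "orthogonal_transformation f" "f b = e"
    using orthogonal_transformation_exists[of b e] assms(1) b(2) by metis
  have lin: "linear f" and isom: "\<And>x y. f x \<bullet> f y = x \<bullet> y"
    using f(1) by (auto simp: orthogonal_transformation_def)
  define C0 where "C0 = {x. x \<bullet> b \<in> {l..u} \<and> norm (x - (x \<bullet> b) *\<^sub>R b) \<le> r}"
  have eq0: "C0 = {x. l \<le> x \<bullet> b} \<inter> {x. x \<bullet> b \<le> u} \<inter> {x. norm (x - (x \<bullet> b) *\<^sub>R b) \<le> r}"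
    by (auto simp: C0_def)
  have "closed C0"
    unfolding eq0 by (intro closed_Int closed_Collect_le continuous_intros)
  then have C0_sets: "C0 \<in> sets lborel" by simp
  have "?Cyl \<subseteq> (\<lambda>y. c + f y) ` C0"
  proof
    fix x assume x: "x \<in> ?Cyl"
    obtain y where y: "x - c = f y"
      using orthogonal_transformation_surj[OF f(1)] by (metis surjD)
    have "f y - (y \<bullet> b) *\<^sub>R e = f (y - (y \<bullet> b) *\<^sub>R b)"
      using lin f(2) by (simp add: linear_diff linear_scale)
    moreover have "(x - c) \<bullet> e = y \<bullet> b" using y f(2) isom by metis
    ultimately have "y \<in> C0"
      using x f(1) y by (simp add: C0_def orthogonal_transformation_norm)
    then show "x \<in> (\<lambda>y. c + f y) ` C0" using y by (force simp: algebra_simps)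
  qed
  then have "hausdorff_measure CARD('n) ?Cyl \<le> hausdorff_measure CARD('n) ((\<lambda>y. c + f y) ` C0)"
    by (rule hausdorff_measure_mono)
  also have "\<dots> \<le> hausdorff_measure CARD('n) C0"
    using f(1) by (intro hausdorff_measure_short_map_le)
      (simp add: dist_norm linear_diff[OF lin, symmetric] orthogonal_transformation_norm)
  also have "\<dots> \<le> emeasure lborel C0"
    using hausdorff_measure_le_lebesgue[of C0] C0_sets by simp
  also have "\<dots> \<le> ennreal (unit_ball_vol (real (CARD('n) - 1)) * r ^ (CARD('n) - 1) * (u - l))"
    using emeasure_axis_cylinder_le[OF b(1) assms(2,3)] by (simp add: C0_def)
  finally show ?thesis .
qed

section \<open>The symmetric difference is swept by the boundary\<close>

text \<open>
The matrix that moves a point \<open>a\<close> along the segment from \<open>a\<close> to \<open>M a\<close>.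
\<close>

definition interp :: "real ^ 'n ^ 'n \<Rightarrow> real \<Rightarrow> real ^ 'n ^ 'n" where
  "interp M s = (1 - s) *\<^sub>R mat 1 + s *\<^sub>R M"

lemma interp_mult: "interp M s *v a = (1 - s) *\<^sub>R a + s *\<^sub>R (M *v a)"
  by (simp add: interp_def matrix_vector_mult_add_rdistrib scaleR_matrix_vector_assoc[symmetric])

text \<open>
If \<open>(1 - s) a = - s M a\<close> with \<open>a \<noteq> 0\<close>, then taking norms gives \<open>s = 1 / 2\<close>. At \<open>s = 1 / 2\<close> the matrix is
singular exactly when \<open>-1\<close> is an eigenvalue of \<open>M\<close>.
\<close>

lemma det_interp_nonzero:
  assumes "\<And>x. norm (M *v x) = norm x" "0 \<le> s" "s \<le> 1" "s \<noteq> 1/2"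
  shows "det (interp M s) \<noteq> 0"
proof -
  have "a = 0" if "interp M s *v a = 0" for a
  proof -
    have "(1 - s) *\<^sub>R a = - (s *\<^sub>R (M *v a))"
      using that by (simp add: interp_mult eq_neg_iff_add_eq_0)
    then have "norm ((1 - s) *\<^sub>R a) = norm (s *\<^sub>R (M *v a))" by simp
    then have "(1 - s) * norm a = s * norm a" using assms by simp
    then show "a = 0" using assms(4) by (auto simp: algebra_simps)
  qed
  then have "invertible (interp M s)"
    by (simp add: invertible_left_inverse matrix_left_invertible_ker)
  then show ?thesis by (simp add: invertible_det_nz)
qed

lemma continuous_on_det:
  fixes F :: "'a::topological_space \<Rightarrow> real ^ 'n ^ 'n"
  assumes "\<And>i j. continuous_on T (\<lambda>s. F s $ i $ j)"
  shows "continuous_on T (\<lambda>s. det (F s))"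
  unfolding det_def
  by (intro continuous_on_sum continuous_on_mult continuous_on_prod continuous_on_const assms)

text \<open>
Cramer's rule exhibits the unique solution \<open>a\<close> of \<open>((1 - s) I + s M) a = x\<close> as a continuous function of \<open>s\<close>.
\<close>

lemma interp_preimage_path:
  fixes M :: "real ^ 'n ^ 'n"
  assumes "\<And>s. s \<in> T \<Longrightarrow> det (interp M s) \<noteq> 0"
  obtains p where "continuous_on T p" "\<And>s. s \<in> T \<Longrightarrow> interp M s *v p s = x"
    "\<And>s a. s \<in> T \<Longrightarrow> interp M s *v a = x \<Longrightarrow> p s = a"
proof -
  define p where "p s = (\<chi> k. det (\<chi> i j. if j = k then x $ i else interp M s $ i $ j) / det (interp M s))"
    for s
  have entries: "continuous_on T (\<lambda>s. interp M s $ i $ j)" for i j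
    by (simp add: interp_def) (intro continuous_intros)
  have "continuous_on T (\<lambda>s. p s $ k)" for k
  proof -
    have "continuous_on T (\<lambda>s. (\<chi> i j. if j = k then x $ i else interp M s $ i $ j) $ i' $ j')" for i' j'
      using entries by (cases "j' = k") auto
    then show ?thesis
      unfolding p_def using assms by (simp, intro continuous_on_divide continuous_on_det entries) auto
  qed
  then have "continuous_on T p"
    by (subst continuous_on_componentwise) (auto simp: Basis_vec_def inner_axis)
  moreover have "(interp M s *v a = x) = (a = p s)" if "s \<in> T" for s a
    unfolding p_def by (rule cramer) (rule assms[OF that])
  ultimately show thesis using that by metis
qed

text \<open>
The path of preimages of \<open>x\<close> starts inside \<open>A\<close> and ends outside, so it crosses the boundary of \<open>A\<close>.
\<close>

lemma boundary_sweep_of_preimage_path: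
  fixes A :: "(real ^ 'n) set"
  assumes "connected T" "T \<subseteq> {0..1}" "\<And>s. s \<in> T \<Longrightarrow> det (interp M s) \<noteq> 0"
    and "s \<in> T" "interp M s *v a = x" "a \<in> A"
    and "s' \<in> T" "interp M s' *v a' = x" "a' \<notin> A"
  shows "\<exists>s\<in>{0..1}. \<exists>a\<in>frontier A. interp M s *v a = x"
proof -
  obtain p where p: "continuous_on T p" "\<And>s. s \<in> T \<Longrightarrow> interp M s *v p s = x"
    "\<And>s a. s \<in> T \<Longrightarrow> interp M s *v a = x \<Longrightarrow> p s = a"
    using interp_preimage_path[of T M x] assms(3) by blast
  have "connected (p ` T)" using p(1) assms(1) by (rule connected_continuous_image)
  moreover have "p ` T \<inter> A \<noteq> {}" "p ` T - A \<noteq> {}"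
    using p(3) assms(4-) by blast+
  ultimately have "p ` T \<inter> frontier A \<noteq> {}" by (rule connected_Int_frontier)
  then show ?thesis using p(2) assms(2) by blast
qed

text \<open>
When the parameter \<open>s\<close> approaches a value \<open>m\<close> for which \<open>x\<close> has no preimage, the preimages of \<open>x\<close> must
become unbounded: along a bounded path \<open>((1 - m) I + m M) a\<^sub>s\<close> would tend to \<open>x\<close>, and the range of a
matrix is closed. As \<open>A\<close> is bounded, the path leaves \<open>A\<close>.
\<close>

lemma boundary_sweep_singular:
  fixes A :: "(real ^ 'n) set"
  assumes "bounded A" "connected T" "T \<subseteq> {0..1}" "\<And>s. s \<in> T \<Longrightarrow> det (interp M s) \<noteq> 0"
    and "s0 \<in> T" "interp M s0 *v a0 = x" "a0 \<in> A"
    and "m islimpt T" "x \<notin> range ((*v) (interp M m))"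
  shows "\<exists>s\<in>{0..1}. \<exists>a\<in>frontier A. interp M s *v a = x"
proof (rule ccontr)
  assume no: "\<not> ?thesis"
  obtain p where p: "\<And>s. s \<in> T \<Longrightarrow> interp M s *v p s = x"
    using interp_preimage_path[of T M x, OF assms(4)] by metis
  have pA: "p s \<in> A" if "s \<in> T" for s
    using boundary_sweep_of_preimage_path[OF assms(2-7) that p[OF that]] no by blast
  obtain B where B: "\<And>a. a \<in> A \<Longrightarrow> norm (M *v a - a) \<le> B"
  proof -
    have "bounded_linear (\<lambda>a. M *v a - a)"
      by (intro bounded_linear_sub matrix_vector_mul_bounded_linear bounded_linear_ident)
    from bounded_linear_image[OF assms(1) this] show thesis
      using that by (auto simp: bounded_iff)
  qed
  obtain t where t: "\<And>n. t n \<in> T" "t \<longlonglongrightarrow> m"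
    using assms(8) by (auto simp: islimpt_sequential)
  have lim: "(\<lambda>n. interp M m *v p (t n)) \<longlonglongrightarrow> x"
  proof (rule Lim_null_comparison[THEN LIM_zero_cancel])
    show "\<forall>\<^sub>F n in sequentially. norm (interp M m *v p (t n) - x) \<le> \<bar>m - t n\<bar> * B"
    proof (intro always_eventually allI)
      fix n
      have "interp M m *v p (t n) - x = (m - t n) *\<^sub>R (M *v p (t n) - p (t n))"
        by (subst p[OF t(1)[of n], symmetric]) (simp add: interp_mult algebra_simps)
      then show "norm (interp M m *v p (t n) - x) \<le> \<bar>m - t n\<bar> * B"
        using B[OF pA[OF t(1)]] by (simp add: mult_left_mono)
    qed
    have "(\<lambda>n. \<bar>m - t n\<bar> * B) \<longlonglongrightarrow> \<bar>m - m\<bar> * B" by (intro tendsto_intros t(2))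
    then show "(\<lambda>n. \<bar>m - t n\<bar> * B) \<longlonglongrightarrow> 0" by simp
  qed
  have closed: "closed (range ((*v) (interp M m)))"
    by (intro closed_subspace linear_subspace_image subspace_UNIV) simp
  have "x \<in> range ((*v) (interp M m))"
    by (rule closed_sequentially[OF closed _ lim]) simp
  with assms(9) show False ..
qed

text \<open>
If \<open>x = M y\<close>, then the path of preimages of \<open>x\<close> under \<open>(1 - s) I + s M\<close> joins \<open>x\<close> (at \<open>s = 0\<close>) to \<open>y\<close>
(at \<open>s = 1\<close>), and \<open>x\<close> belongs to the symmetric difference exactly when one of the two ends is in \<open>A\<close>
and the other is not. If the matrix is singular at \<open>s = 1 / 2\<close>, its range is a null set; off this
range the half of the path that starts at the end in \<open>A\<close> escapes to infinity and thus meets the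
boundary of \<open>A\<close> already.
\<close>

lemma sym_diff_subset_boundary_sweep:
  fixes A :: "(real ^ 'n) set" and M :: "real ^ 'n ^ 'n"
  assumes "bounded A" and isom: "\<And>x. norm (M *v x) = norm x"
  obtains Z where "negligible Z"
    "sym_diff A ((*v) M ` A) \<subseteq> Z \<union> {interp M s *v a | s a. s \<in> {0..1} \<and> a \<in> frontier A}"
proof
  define h where "h = (1/2 :: real)"
  define Z where "Z = (if det (interp M h) = 0 then range ((*v) (interp M h)) else {})"
  have "negligible (range ((*v) (interp M h)))" if "det (interp M h) = 0"
    using that det_nz_iff_inj[of "(*v) (interp M h)"]
    by (intro negligible_linear_singular_image) auto
  then show "negligible Z" by (simp add: Z_def)
  have M_surj: "\<exists>y. M *v y = x" for x
  proof -
    have "det (interp M 1) \<noteq> 0" using isom by (intro det_interp_nonzero) auto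
    then have "det M \<noteq> 0" by (simp add: interp_def)
    then show ?thesis using cramer by blast
  qed
  have inj: "y = z" if "M *v y = M *v z" for y z
    using isom[of "y - z"] that by (simp add: matrix_vector_mult_diff_distrib)
  show "sym_diff A ((*v) M ` A) \<subseteq> Z \<union> {interp M s *v a | s a. s \<in> {0..1} \<and> a \<in> frontier A}"
  proof
    fix x assume x: "x \<in> sym_diff A ((*v) M ` A)"
    obtain y where y: "M *v y = x" using M_surj by blast
    have xy: "x \<in> A \<and> y \<notin> A \<or> x \<notin> A \<and> y \<in> A" using x y inj by blast
    have ends: "interp M 0 *v x = x" "interp M 1 *v y = x" by (simp_all add: interp_mult y)
    have nz: "det (interp M s) \<noteq> 0" if "s \<in> {0..1}" "s \<noteq> h" for s
      using that isom by (intro det_interp_nonzero) (auto simp: h_def)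
    have "\<exists>s\<in>{0..1}. \<exists>a\<in>frontier A. interp M s *v a = x" if "x \<notin> Z"
    proof (cases "det (interp M h) = 0")
      case False
      have "det (interp M s) \<noteq> 0" if "s \<in> {0..1}" for s using nz[OF that] False by blast
      then show ?thesis
        using xy ends boundary_sweep_of_preimage_path[of "{0..1}" M 0 x x A 1 y]
          boundary_sweep_of_preimage_path[of "{0..1}" M 1 y x A 0 x] by auto
    next
      case True
      then have xr: "x \<notin> range ((*v) (interp M h))" using \<open>x \<notin> Z\<close> by (simp add: Z_def)
      have lim: "h islimpt {0..<h}" "h islimpt {h<..1}"
        by (simp_all add: h_def islimpt_Ico islimpt_Ioc)
      from xy show ?thesis
      proof (elim disjE conjE)
        assume "x \<in> A"
        show ?thesis
          by (rule boundary_sweep_singular[of A "{0..<h}" M 0 x x h])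
            (use assms(1) \<open>x \<in> A\<close> ends lim xr nz in \<open>auto simp: h_def\<close>)
      next
        assume "y \<in> A"
        show ?thesis
          by (rule boundary_sweep_singular[of A "{h<..1}" M 1 y x h])
            (use assms(1) \<open>y \<in> A\<close> ends lim xr nz in \<open>auto simp: h_def\<close>)
      qed
    qed
    then show "x \<in> Z \<union> {interp M s *v a | s a. s \<in> {0..1} \<and> a \<in> frontier A}" by blast
  qed
qed

section \<open>Volume of the swept region\<close>

text \<open>
By Jung's theorem \<open>B\<close> lies in a ball of radius \<open>r\<close> about some \<open>c\<close>. While \<open>c\<close> moves along the segment
from \<open>c\<close> to \<open>M c\<close>, the points of \<open>B\<close>, each moving from \<open>a\<close> to \<open>M a\<close>, stay within distance \<open>r\<close> of it, because \<open>(1 - s) I + s M\<close> does not increase norms. So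
the region swept by \<open>B\<close> lies in a cylinder of radius \<open>r\<close> around that segment, prolonged by \<open>r\<close> at both
ends. The centre \<open>c\<close> need not belong to \<open>B\<close>; its displacement exceeds that of \<open>b\<close> by at most \<open>2 r\<close>,
which makes the total length at most \<open>w + 4 r\<close>.
\<close>

lemma hausdorff_measure_sweep_le:
  fixes M :: "real ^ 'n ^ 'n" and B :: "(real ^ 'n) set"
  assumes isom: "\<And>x. norm (M *v x) = norm x" and "bounded B" and b: "b \<in> B" "norm (b - M *v b) \<le> w"
  defines "r \<equiv> sqrt (real CARD('n) / (2 * (real CARD('n) + 1))) * diameter B"
  shows "hausdorff_measure CARD('n) {interp M s *v a | s a. s \<in> {0..1} \<and> a \<in> B}
    \<le> ennreal (unit_ball_vol (real (CARD('n) - 1)) * r ^ (CARD('n) - 1) * (w + 4 * r))"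
proof -
  obtain c where c: "B \<subseteq> cball c r"
    using jung[OF assms(2)] by (auto simp: r_def)
  have "0 \<le> r" using diameter_ge_0[OF assms(2)] by (simp add: r_def)
  have rad: "norm (a - c) \<le> r" if "a \<in> B" for a
    using c that by (auto simp: dist_norm norm_minus_commute)
  define L where "L = norm (M *v c - c)"
  have "M *v c - c = (M *v (c - b) - (c - b)) - (b - M *v b)"
    by (simp add: matrix_vector_mult_diff_distrib)
  then have "L \<le> norm (M *v (c - b) - (c - b)) + norm (b - M *v b)"
    unfolding L_def by (metis norm_triangle_ineq4)
  also have "norm (M *v (c - b) - (c - b)) \<le> norm (c - b) + norm (c - b)"
    using norm_triangle_ineq4[of "M *v (c - b)" "c - b"] isom by simp
  finally have L: "L \<le> w + 2 * r"
    using rad[OF b(1)] b(2) by (simp add: norm_minus_commute)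
  have "0 \<le> L" by (simp add: L_def)
  obtain e :: "real ^ 'n" where e: "norm e = 1" "M *v c - c = L *\<^sub>R e"
  proof (cases "L = 0")
    case True
    \<comment> \<open>The centre is a fixed point, so every direction will do.\<close>
    then show thesis using that[of "axis undefined 1"] by (simp add: L_def)
  next
    case False
    then show thesis using that[of "(M *v c - c) /\<^sub>R L"] by (simp add: L_def)
  qed
  have "{interp M s *v a | s a. s \<in> {0..1} \<and> a \<in> B}
      \<subseteq> {x. (x - c) \<bullet> e \<in> {-r..L + r} \<and> norm ((x - c) - ((x - c) \<bullet> e) *\<^sub>R e) \<le> r}"
  proof safe
    fix s :: real and a assume s: "s \<in> {0..1}" and "a \<in> B"
    define v where "v = interp M s *v (a - c)"
    have "norm v \<le> (1 - s) * norm (a - c) + s * norm (M *v (a - c))"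
      unfolding v_def interp_mult using s by (intro norm_triangle_le) simp
    also have "\<dots> = norm (a - c)" unfolding isom by (simp add: algebra_simps)
    finally have v: "norm v \<le> r" using rad[OF \<open>a \<in> B\<close>] by simp
    have x: "interp M s *v a - c = (s * L) *\<^sub>R e + v"
      unfolding v_def scaleR_scaleR[symmetric] e(2)[symmetric]
      by (simp add: interp_mult matrix_vector_mult_diff_distrib algebra_simps)
    have ee: "e \<bullet> e = 1" using e(1) by (simp add: norm_eq_1)
    have ve: "\<bar>v \<bullet> e\<bar> \<le> r" using Cauchy_Schwarz_ineq2[of v e] e(1) v by simp
    have xe: "(interp M s *v a - c) \<bullet> e = s * L + v \<bullet> e" by (simp add: x inner_add_left ee)
    have "0 \<le> s * L" "s * L \<le> L" using s \<open>0 \<le> L\<close> by (auto intro: mult_left_le_one_le)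
    then show "(interp M s *v a - c) \<bullet> e \<in> {-r..L + r}" using ve by (auto simp: xe)
    have "(norm (v - (v \<bullet> e) *\<^sub>R e))\<^sup>2 = (norm v)\<^sup>2 - (v \<bullet> e)\<^sup>2"
      unfolding power2_norm_eq_inner
      by (simp add: inner_diff inner_commute ee) (simp add: power2_eq_square)
    then have "(norm (v - (v \<bullet> e) *\<^sub>R e))\<^sup>2 \<le> (norm v)\<^sup>2" by simp
    then have "norm (v - (v \<bullet> e) *\<^sub>R e) \<le> norm v" by (rule power2_le_imp_le) simp
    moreover have "interp M s *v a - c - ((interp M s *v a - c) \<bullet> e) *\<^sub>R e = v - (v \<bullet> e) *\<^sub>R e"
      unfolding xe by (simp add: x scaleR_left_distrib)
    ultimately show "norm (interp M s *v a - c - ((interp M s *v a - c) \<bullet> e) *\<^sub>R e) \<le> r"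
      using v by simp
  qed
  then have "hausdorff_measure CARD('n) {interp M s *v a | s a. s \<in> {0..1} \<and> a \<in> B}
    \<le> hausdorff_measure CARD('n) {x. (x - c) \<bullet> e \<in> {-r..L + r} \<and> norm ((x - c) - ((x - c) \<bullet> e) *\<^sub>R e) \<le> r}"
    by (rule hausdorff_measure_mono)
  also have "\<dots> \<le> ennreal (unit_ball_vol (real (CARD('n) - 1)) * r ^ (CARD('n) - 1) * (L + r - - r))"
    using \<open>0 \<le> r\<close> \<open>0 \<le> L\<close> by (intro hausdorff_measure_cylinder_le e(1)) auto
  also have "\<dots> \<le> ennreal (unit_ball_vol (real (CARD('n) - 1)) * r ^ (CARD('n) - 1) * (w + 4 * r))"
    using L \<open>0 \<le> r\<close> by (intro ennreal_leI mult_left_mono) auto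
  finally show ?thesis .
qed

lemma hausdorff_measure_negligible:
  fixes Z :: "(real ^ 'n) set"
  assumes "negligible Z"
  shows "hausdorff_measure CARD('n) Z = 0"
proof -
  have "hausdorff_measure CARD('n) Z \<le> emeasure lebesgue Z"
    using hausdorff_measure_le_lebesgue[OF negligible_imp_sets[OF assms]] by simp
  also have "\<dots> = 0" using assms by (simp add: negligible_iff_null_sets null_setsD1)
  finally show ?thesis by simp
qed

definition jung_factor :: "nat \<Rightarrow> real" where
  "jung_factor d = (2 * real d / (real d + 1)) powr ((real d - 1) / 2)"

text \<open>
The constant is the factor lost when a set of diameter \<open>D\<close>, which enters the Hausdorff measure like a
\<open>(d - 1)\<close>-dimensional ball of radius \<open>D / 2\<close>, is replaced by a ball of the radius in Jung's theorem.
\<close>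

lemma jung_factor_eq_power:
  assumes "0 < d"
  shows "jung_factor d = (2 * sqrt (real d / (2 * (real d + 1)))) ^ (d - 1)"
proof -
  define q where "q = 2 * real d / (real d + 1)"
  have "0 < q" using assms by (simp add: q_def)
  have "2 * sqrt (real d / (2 * (real d + 1))) = sqrt (4 * (real d / (2 * (real d + 1))))"
    by (simp only: real_sqrt_mult real_sqrt_four)
  also have "\<dots> = sqrt q" by (simp add: q_def field_simps)
  finally have "(2 * sqrt (real d / (2 * (real d + 1)))) ^ (d - 1) = (q powr (1/2)) powr real (d - 1)"
    using \<open>0 < q\<close> by (simp add: powr_half_sqrt powr_realpow)
  also have "\<dots> = q powr ((real d - 1) / 2)"
    using assms by (simp add: powr_powr of_nat_diff)
  finally show ?thesis by (simp add: jung_factor_def q_def)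
qed

text \<open>
Each member of a cover of the boundary sweeps out a region bounded by a cylinder, and together with
a null set these regions cover the symmetric difference. Members of the cover that miss the boundary
are discarded, since nothing is known about the displacement of their points.
\<close>

lemma hausdorff_measure_sym_diff_le_cover:
  fixes A :: "(real ^ 'n) set" and M :: "real ^ 'n ^ 'n"
  assumes "bounded A" and isom: "\<And>x. norm (M *v x) = norm x"
    and w: "0 \<le> w" "\<And>a. a \<in> frontier A \<Longrightarrow> norm (a - M *v a) \<le> w"
    and B: "\<And>j. bounded (B j)" "\<And>j::nat. diameter (B j) \<le> \<delta>" "frontier A \<subseteq> (\<Union>j. B j)"
  shows "hausdorff_measure CARD('n) (sym_diff A ((*v) M ` A))
    \<le> ennreal (jung_factor CARD('n) * (w + 4 * \<delta>)) *
      (ennreal (unit_ball_vol (real (CARD('n) - 1)) / 2 ^ (CARD('n) - 1))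
        * (\<Sum>j. ennreal (diam_pow (CARD('n) - 1) (B j))))"
proof -
  let ?d = "CARD('n)"
  define \<kappa> where "\<kappa> = sqrt (real ?d / (2 * (real ?d + 1)))"
  define \<omega> where "\<omega> = unit_ball_vol (real (?d - 1))"
  have \<kappa>: "0 \<le> \<kappa>" "\<kappa> \<le> 1" by (simp_all add: \<kappa>_def)
  have \<omega>: "0 \<le> \<omega>" by (simp add: \<omega>_def)
  have jf: "jung_factor ?d = 2 ^ (?d - 1) * \<kappa> ^ (?d - 1)"
    by (simp add: jung_factor_eq_power \<kappa>_def power_mult_distrib)
  have \<delta>: "0 \<le> \<delta>" using diameter_ge_0[OF B(1)] B(2) by (meson order_trans)
  define P where "P j = (if B j \<inter> frontier A = {} then {}
    else {interp M s *v a | s a. s \<in> {0..1} \<and> a \<in> B j})" for j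
  obtain Z where Z: "negligible Z"
    "sym_diff A ((*v) M ` A) \<subseteq> Z \<union> {interp M s *v a | s a. s \<in> {0..1} \<and> a \<in> frontier A}"
    using sym_diff_subset_boundary_sweep[OF assms(1) isom] .
  have piece: "hausdorff_measure ?d (P j)
      \<le> ennreal (jung_factor ?d * (w + 4 * \<delta>)) * (ennreal (\<omega> / 2 ^ (?d - 1)) * ennreal (diam_pow (?d - 1) (B j)))"
    for j
  proof (cases "B j \<inter> frontier A = {}")
    case True
    then have "hausdorff_measure ?d (P j) = 0"
      using hausdorff_measure_negligible[OF negligible_empty] by (simp add: P_def)
    then show ?thesis by simp
  next
    case False
    then obtain b where b: "b \<in> B j" "b \<in> frontier A" by blast
    define r where "r = \<kappa> * diameter (B j)"
    have "0 \<le> r" using \<kappa> diameter_ge_0[OF B(1)] by (simp add: r_def)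
    have "r \<le> \<delta>"
      using \<kappa> diameter_ge_0[OF B(1)[of j]] B(2)[of j] unfolding r_def
      by (meson mult_left_le_one_le order_trans)
    have "hausdorff_measure ?d (P j) \<le> ennreal (\<omega> * r ^ (?d - 1) * (w + 4 * r))"
      using hausdorff_measure_sweep_le[OF isom B(1) b(1) w(2)[OF b(2)]] False
      by (simp add: P_def \<omega>_def r_def \<kappa>_def)
    also have "\<dots> \<le> ennreal (\<omega> * r ^ (?d - 1) * (w + 4 * \<delta>))"
      using \<open>0 \<le> r\<close> \<open>r \<le> \<delta>\<close> \<omega> by (intro ennreal_leI mult_left_mono) auto
    also have "\<omega> * r ^ (?d - 1) * (w + 4 * \<delta>)
        = jung_factor ?d * (w + 4 * \<delta>) * (\<omega> / 2 ^ (?d - 1) * diam_pow (?d - 1) (B j))"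
      using b(1) by (auto simp: jf r_def diam_pow_def power_mult_distrib)
    also have "ennreal \<dots> = ennreal (jung_factor ?d * (w + 4 * \<delta>))
        * (ennreal (\<omega> / 2 ^ (?d - 1)) * ennreal (diam_pow (?d - 1) (B j)))"
      using w(1) \<delta> \<omega> \<kappa> diameter_ge_0[OF B(1)]
      by (simp add: ennreal_mult'[symmetric] ennreal_mult''[symmetric] jf diam_pow_def)
    finally show ?thesis .
  qed
  have "sym_diff A ((*v) M ` A) \<subseteq> (\<Union>j. case_nat Z P j)"
  proof
    fix x assume "x \<in> sym_diff A ((*v) M ` A)"
    then consider "x \<in> Z" | s a where "x = interp M s *v a" "s \<in> {0..1}" "a \<in> frontier A"
      using Z(2) by blast
    then show "x \<in> (\<Union>j. case_nat Z P j)"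
    proof cases
      case 1
      then have "x \<in> case_nat Z P 0" by simp
      then show ?thesis by blast
    next
      case 2
      then obtain j where "a \<in> B j" using B(3) by blast
      with 2 have "x \<in> case_nat Z P (Suc j)" by (auto simp: P_def)
      then show ?thesis by blast
    qed
  qed
  then have "hausdorff_measure ?d (sym_diff A ((*v) M ` A)) \<le> hausdorff_measure ?d (\<Union>j. case_nat Z P j)"
    by (rule hausdorff_measure_mono)
  also have "\<dots> \<le> (\<Sum>j. hausdorff_measure ?d (case_nat Z P j))"
    by (rule hausdorff_measure_UN_le)
  also have "\<dots> = (\<Sum>j. hausdorff_measure ?d (P j))"
    by (subst suminf_offset[of _ 1]) (simp_all add: hausdorff_measure_negligible[OF Z(1)])
  also have "\<dots> \<le> (\<Sum>j. ennreal (jung_factor ?d * (w + 4 * \<delta>))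
      * (ennreal (\<omega> / 2 ^ (?d - 1)) * ennreal (diam_pow (?d - 1) (B j))))"
    by (intro suminf_le piece) auto
  finally show ?thesis by (simp add: \<omega>_def)
qed

text \<open>
If \<open>M\<close> fixes the boundary, the segments from \<open>a\<close> to \<open>M a\<close> degenerate to fixed points of \<open>M\<close>, and a fixed
point belongs to \<open>A\<close> if and only if it belongs to \<open>M A\<close>.
\<close>

lemma sym_diff_negligible_if_frontier_fixed:
  fixes A :: "(real ^ 'n) set" and M :: "real ^ 'n ^ 'n"
  assumes "bounded A" and isom: "\<And>x. norm (M *v x) = norm x"
    and fixed: "\<And>a. a \<in> frontier A \<Longrightarrow> M *v a = a"
  shows "negligible (sym_diff A ((*v) M ` A))"
proof -
  obtain Z where Z: "negligible Z"
    "sym_diff A ((*v) M ` A) \<subseteq> Z \<union> {interp M s *v a | s a. s \<in> {0..1} \<and> a \<in> frontier A}"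
    using sym_diff_subset_boundary_sweep[OF assms(1) isom] .
  have "x \<in> Z" if x: "x \<in> sym_diff A ((*v) M ` A)" for x
  proof (rule ccontr)
    assume "x \<notin> Z"
    then obtain s a where "x = interp M s *v a" "a \<in> frontier A" using Z(2) x by blast
    then have "x = a" using fixed by (simp add: interp_mult scaleR_left_distrib[symmetric])
    then have Mx: "M *v x = x" using fixed \<open>a \<in> frontier A\<close> by simp
    have "y = x" if "M *v y = x" for y
      using isom[of "y - x"] that Mx by (simp add: matrix_vector_mult_diff_distrib)
    then show False using x Mx by force
  qed
  then show ?thesis using negligible_subset[OF Z(1)] by blast
qed

theorem theorem2:
  fixes A :: "(real ^ 'n) set" and M :: "real ^ 'n ^ 'n"
  assumes "bounded A"
    and "rotation_matrix M"
  shows "hausdorff_measure CARD('n) (sym_diff A ((*v) M ` A))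
    \<le> ennreal ((2 * real CARD('n) / (real CARD('n) + 1)) powr ((real CARD('n) - 1) / 2))
        * (SUP a\<in>frontier A. ennreal (norm (a - M *v a)))
        * hausdorff_measure (CARD('n) - 1) (frontier A)"
proof (cases "A = {}")
  case True
  have "hausdorff_measure CARD('n) ({} :: (real ^ 'n) set) = 0"
    by (rule hausdorff_measure_negligible) simp
  then show ?thesis using True by simp
next
  case False
  let ?H = "hausdorff_measure CARD('n) (sym_diff A ((*v) M ` A))"
  define K where "K = jung_factor CARD('n)"
  have "0 < K" by (simp add: K_def jung_factor_def)
  have isom: "norm (M *v x) = norm x" for x
    using assms(2) orthogonal_transformation_matrix[of "(*v) M"]
    by (auto simp: rotation_matrix_def intro: orthogonal_transformation_norm)
  obtain a0 where a0: "a0 \<in> frontier A"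
    "\<And>a. a \<in> frontier A \<Longrightarrow> norm (a - M *v a) \<le> norm (a0 - M *v a0)"
    "(SUP a\<in>frontier A. ennreal (norm (a - M *v a))) = ennreal (norm (a0 - M *v a0))"
    using displacement_SUP_attained[OF assms(1) False, of M] by blast
  define w where "w = norm (a0 - M *v a0)"
  have w: "0 \<le> w" "\<And>a. a \<in> frontier A \<Longrightarrow> norm (a - M *v a) \<le> w"
    using a0 by (auto simp: w_def)
  have "?H \<le> ennreal K * ennreal w * hausdorff_measure (CARD('n) - 1) (frontier A)"
  proof (cases "hausdorff_measure (CARD('n) - 1) (frontier A) = \<infinity>")
    case True
    \<comment> \<open>The bound is infinite unless \<open>w = 0\<close>, where it is \<open>0 * \<infinity> = 0\<close> and covers say nothing.\<close>
    show ?thesis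
    proof (cases "w = 0")
      case True
      then have "M *v a = a" if "a \<in> frontier A" for a using w(2)[OF that] by simp
      then show ?thesis
        using hausdorff_measure_negligible[OF sym_diff_negligible_if_frontier_fixed[OF assms(1) isom]]
        by simp
    next
      case False
      then show ?thesis using True w(1) \<open>0 < K\<close> by (simp add: ennreal_mult_eq_top_iff ennreal_mult_top)
    qed
  next
    case False
    then obtain h where h: "0 \<le> h" "hausdorff_measure (CARD('n) - 1) (frontier A) = ennreal h"
      by (cases "hausdorff_measure (CARD('n) - 1) (frontier A)") auto
    \<comment> \<open>Covers of mesh \<open>\<delta>\<close> that are optimal up to \<open>\<delta>\<close>; afterwards \<open>\<delta>\<close> tends to zero.\<close>
    have "?H \<le> ennreal (K * (w + 4 * \<delta>) * (h + \<delta>))" if \<delta>: "0 < \<delta>" for \<delta>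
    proof -
      have pre: "hausdorff_pre (CARD('n) - 1) \<delta> (frontier A) \<le> ennreal h"
        using hausdorff_pre_le_measure[OF \<delta>] h(2) by metis
      then have "hausdorff_pre (CARD('n) - 1) \<delta> (frontier A) < \<infinity>"
        by (simp add: le_less_trans)
      then obtain B :: "nat \<Rightarrow> (real ^ 'n) set" where B: "\<And>j. bounded (B j)" "\<And>j. diameter (B j) \<le> \<delta>"
        "frontier A \<subseteq> (\<Union>j. B j)"
        "ennreal (unit_ball_vol (real (CARD('n) - 1)) / 2 ^ (CARD('n) - 1))
          * (\<Sum>j. ennreal (diam_pow (CARD('n) - 1) (B j)))
          \<le> hausdorff_pre (CARD('n) - 1) \<delta> (frontier A) + ennreal \<delta>"
        using \<delta> by (rule hausdorff_pre_obtain_cover) blast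
      have "?H \<le> ennreal (K * (w + 4 * \<delta>)) * (ennreal (unit_ball_vol (real (CARD('n) - 1)) / 2 ^ (CARD('n) - 1))
          * (\<Sum>j. ennreal (diam_pow (CARD('n) - 1) (B j))))"
        unfolding K_def by (rule hausdorff_measure_sym_diff_le_cover[OF assms(1) isom w B(1-3)])
      also have "\<dots> \<le> ennreal (K * (w + 4 * \<delta>)) * (ennreal h + ennreal \<delta>)"
        using order_trans[OF B(4) add_right_mono[OF pre]] by (rule mult_left_mono) simp
      also have "\<dots> = ennreal (K * (w + 4 * \<delta>) * (h + \<delta>))"
        using h(1) \<delta> w(1) \<open>0 < K\<close> by (simp add: ennreal_mult ennreal_plus[symmetric] del: ennreal_plus)
      finally show ?thesis .
    qed
    then have "\<forall>\<^sub>F \<delta> in at_right 0. ?H \<le> ennreal (K * (w + 4 * \<delta>) * (h + \<delta>))"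
      by (auto simp: eventually_at_right_field intro: exI[of _ 1])
    moreover have "((\<lambda>\<delta>. ennreal (K * (w + 4 * \<delta>) * (h + \<delta>))) \<longlongrightarrow> ennreal (K * (w + 4 * 0) * (h + 0))) (at_right 0)"
      by (intro tendsto_intros)
    ultimately have "?H \<le> ennreal (K * (w + 4 * 0) * (h + 0))"
      by (intro tendsto_lowerbound) auto
    also have "\<dots> = ennreal K * ennreal w * ennreal h"
      using h(1) w(1) \<open>0 < K\<close> by (simp add: ennreal_mult)
    finally show ?thesis unfolding h(2) .
  qed
  then show ?thesis by (simp add: a0(3) w_def K_def jung_factor_def)
qed

end
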